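(* Let $d\ge1$, $n\ge d+1$, and let $(\xi_1,\dots,\xi_n)$ be an exchangeable tuple of random vectors in $\mathbb{R}^d$, i.e. $(\xi_1,\dots,\xi_n)\stackrel{d}{=}(\xi_{\sigma(1)},\dots,\xi_{\sigma(n)})$ for every permutation $\sigma$ of $\{1,\dots,n\}$. Let $S_k=\xi_1+\dots+\xi_k$, $1\le k\le n$. Assume $S_n=0$ a.s. and that any $d$ random vectors among $S_1,\dots,S_{n-1}$ are linearly independent a.s. Then $$\mathbb{P}[0\in\mathrm{Conv}(S_1,\dots,S_{n-1})]=\frac{2}{n!}\left(\left[{n\atop d+2}\right]+\left[{n\atop d+4}\right]+\dots\right),$$ where the Stirling numbers of the first kind $\left[{n\atop k}\right]$ are defined by $t(t+1)\cdots(t+n-1)=\sum_{k=1}^n\left[{n\atop k}\right]t^k$, with $\left[{n\atop k}\right]=0$ for $k\notin\{1,\dots,n\}$.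
   Context: $\mathrm{Conv}$ denotes the convex hull. *)

theory Defs
  imports "HOL-Probability.Probability" "HOL-Combinatorics.Stirling"
begin

definition psum :: "(nat \<Rightarrow> 'a \<Rightarrow> 'v::real_vector) \<Rightarrow> nat \<Rightarrow> 'a \<Rightarrow> 'v" where
  "psum \<xi> k \<omega> = (\<Sum>i\<in>{1..k}. \<xi> i \<omega>)"

end

theory Submission
  imports Defs "HOL-Combinatorics.Multiset_Permutations"
begin

text \<open>
  By Abel summation, a relation with nonnegative coefficients between the partial sums of
  \<open>\<xi> (\<sigma> 1), \<dots>, \<xi> (\<sigma> n)\<close> is a vector \<open>z\<close> of the space \<open>L = {z. \<Sum>i. z i *\<^sub>R \<xi> i = 0}\<close> that is
  monotone along \<open>\<sigma>\<close>; by general position it can be perturbed to a strictly monotone one.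
  So the permutations \<open>\<sigma>\<close> with \<open>0\<close> in the hull correspond to the Weyl chambers
  of the braid arrangement met by \<open>L\<close>, a generic space of codimension \<open>d\<close>. Their number \<open>N n d\<close>
  satisfies the recurrence \<open>N n d = N (n - 1) (d - 1) + (n - 1) * N (n - 1) d\<close>: inside a chamber of the
  coordinates other than \<open>a\<close>, the walls \<open>z a = z b\<close> are disjoint, so the number of pieces is one more
  than the number of walls met by \<open>L\<close>. Forgetting the coordinate \<open>a\<close> amounts to projecting along \<open>\<xi> a\<close>, and
  restricting to the wall \<open>z a = z b\<close> amounts to replacing \<open>\<xi> b\<close> by \<open>\<xi> b + \<xi> a\<close>; both keep general
  position. This is the recurrence of the Stirling sums. By exchangeability, \<open>n!\<close> times
  the probability is the expected number of such permutations, which is almost surely \<open>N n d\<close>.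
\<close>

section \<open>Measurability of linear independence and of the hull event\<close>

text \<open>Independence of an indexed family: a repeated vector makes it dependent, which
  independence of the image set would not record.\<close>

definition lin_indep :: "'i set \<Rightarrow> ('i \<Rightarrow> 'v::real_vector) \<Rightarrow> bool" where
  "lin_indep I S \<longleftrightarrow> (\<forall>c. (\<Sum>k\<in>I. c k *\<^sub>R S k) = 0 \<longrightarrow> (\<forall>k\<in>I. c k = 0))"

lemma lin_indepI_independent:
  assumes "finite I" "inj_on S I" "independent (S ` I)"
  shows "lin_indep I S"
  unfolding lin_indep_def
proof (intro allI impI ballI)
  fix c :: "_ \<Rightarrow> real" and k
  assume c: "(\<Sum>k\<in>I. c k *\<^sub>R S k) = 0" and k: "k \<in> I"
  have "(\<Sum>v\<in>S ` I. c (inv_into I S v) *\<^sub>R v) = (\<Sum>k\<in>I. c k *\<^sub>R S k)"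
    by (simp add: sum.reindex[OF assms(2)] inv_into_f_f[OF assms(2)])
  then have "c (inv_into I S (S k)) = 0"
    using independentD[OF assms(3), of "S ` I" "\<lambda>v. c (inv_into I S v)" "S k"] assms(1) c k by simp
  then show "c k = 0" by (simp add: inv_into_f_f[OF assms(2) k])
qed

text \<open>With as many vectors as the dimension, independence is an open algebraic condition. This
  makes it a measurable event, since the determinant is a polynomial in the coordinates.
  \<open>h\<close> labels the columns by the index type of the matrix.\<close>

lemma lin_indep_iff_det:
  fixes S :: "'i \<Rightarrow> real ^ 'd"
  assumes h: "bij_betw h (UNIV :: 'd set) I"
  shows "lin_indep I S \<longleftrightarrow> det (\<chi> i j. S (h j) $ i) \<noteq> 0"
proof -
  let ?A = "\<chi> i j. S (h j) $ i"
  have col: "column j ?A = S (h j)" for j by (simp add: column_def)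
  have sum: "(\<Sum>k\<in>I. c k *\<^sub>R S k) = (\<Sum>j\<in>UNIV. c (h j) *s column j ?A)" for c
    by (subst sum.reindex_bij_betw[OF h, symmetric]) (simp add: col scalar_mult_eq_scaleR)
  have "lin_indep I S \<longleftrightarrow> (\<forall>c. (\<Sum>j\<in>UNIV. c j *s column j ?A) = 0 \<longrightarrow> (\<forall>j. c j = 0))"
    unfolding lin_indep_def sum
  proof (intro iffI allI impI ballI)
    fix c j
    assume *: "\<forall>c. (\<Sum>j\<in>UNIV. c (h j) *s column j ?A) = 0 \<longrightarrow> (\<forall>k\<in>I. c k = 0)"
      and c: "(\<Sum>j\<in>UNIV. c j *s column j ?A) = 0"
    have inv: "inv_into UNIV h (h j) = j" for j using h by (simp add: bij_betw_def)
    show "c j = 0"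
      using *[rule_format, of "\<lambda>k. c (inv_into UNIV h k)" "h j"] c bij_betwE[OF h] by (simp add: inv)
  next
    fix c k
    assume *: "\<forall>c. (\<Sum>j\<in>UNIV. c j *s column j ?A) = 0 \<longrightarrow> (\<forall>j. c j = 0)"
      and c: "(\<Sum>j\<in>UNIV. c (h j) *s column j ?A) = 0" and "k \<in> I"
    then obtain j where "k = h j" using bij_betw_imp_surj_on[OF h] by blast
    then show "c k = 0" using *[rule_format, of "\<lambda>j. c (h j)"] c by blast
  qed
  also have "\<dots> \<longleftrightarrow> det ?A \<noteq> 0"
    unfolding matrix_left_invertible_independent_columns[symmetric] invertible_left_inverse[symmetric]
      invertible_det_nz ..
  finally show ?thesis .
qed

lemma sets_lin_indep:
  fixes S :: "'i \<Rightarrow> 'a \<Rightarrow> real ^ 'd"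
  assumes "finite I" "card I = CARD('d)" and meas: "\<And>k. k \<in> I \<Longrightarrow> S k \<in> borel_measurable M"
  shows "{\<omega> \<in> space M. lin_indep I (\<lambda>k. S k \<omega>)} \<in> sets M"
proof -
  obtain h where h: "bij_betw h (UNIV :: 'd set) I"
    using finite_same_card_bij[OF finite assms(1) assms(2)[symmetric]] by blast
  have "(\<lambda>\<omega>. S (h j) \<omega> $ i) \<in> borel_measurable M" for i j
    by (rule measurable_compose[OF meas borel_measurable_continuous_onI])
       (use bij_betwE[OF h] in \<open>auto intro: continuous_intros\<close>)
  then have "(\<lambda>\<omega>. det (\<chi> i j. S (h j) \<omega> $ i)) \<in> borel_measurable M"
    unfolding det_def by (simp, measurable)
  then show ?thesis unfolding lin_indep_iff_det[OF h] by measurable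
qed

text \<open>Strict separation from finitely many points is an open condition on the normal
  \<open>y\<close>, so \<open>y\<close> can be taken from a dense set. A countable \<open>D\<close>
  then turns the hull event into a countable combination of measurable events.\<close>

lemma zero_notin_hull_iff_separated:
  fixes S :: "'i \<Rightarrow> 'v::euclidean_space"
  assumes "finite K" and dense: "\<And>X. open X \<Longrightarrow> X \<noteq> {} \<Longrightarrow> \<exists>y\<in>D. y \<in> X"
  shows "0 \<notin> convex hull (S ` K) \<longleftrightarrow> (\<exists>y\<in>D. \<forall>k\<in>K. 0 < y \<bullet> S k)"
proof
  assume "0 \<notin> convex hull (S ` K)"
  moreover have "closed (convex hull (S ` K))"
    using assms(1) by (simp add: compact_imp_closed finite_imp_compact_convex_hull)
  ultimately obtain a b where ab: "0 < b" "\<forall>v\<in>convex hull (S ` K). b < a \<bullet> v"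
    using separating_hyperplane_closed_0[OF convex_convex_hull] by blast
  let ?X = "\<Inter>k\<in>K. {y. 0 < y \<bullet> S k}"
  have "open ?X"
    using assms(1) by (intro open_INT ballI open_Collect_less continuous_intros) auto
  moreover have "a \<in> ?X" using ab by (force intro: hull_inc)
  ultimately show "\<exists>y\<in>D. \<forall>k\<in>K. 0 < y \<bullet> S k" using dense[of ?X] by blast
next
  assume "\<exists>y\<in>D. \<forall>k\<in>K. 0 < y \<bullet> S k"
  then obtain y where "S ` K \<subseteq> {v. 0 < y \<bullet> v}" by auto
  then have "convex hull (S ` K) \<subseteq> {v. 0 < y \<bullet> v}"
    by (rule hull_minimal) (rule convex_halfspace_gt)
  then show "0 \<notin> convex hull (S ` K)" by auto
qed

lemma sets_zero_in_hull:
  fixes S :: "'i \<Rightarrow> 'a \<Rightarrow> 'v::euclidean_space"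
  assumes fin: "finite K" and meas: "\<And>k. k \<in> K \<Longrightarrow> S k \<in> borel_measurable M"
  shows "{\<omega> \<in> space M. 0 \<in> convex hull ((\<lambda>k. S k \<omega>) ` K)} \<in> sets M"
proof -
  obtain D :: "'v set" where D: "countable D" "\<And>X. open X \<Longrightarrow> X \<noteq> {} \<Longrightarrow> \<exists>y\<in>D. y \<in> X"
    using countable_dense_setE by metis
  have "0 \<notin> convex hull ((\<lambda>k. S k \<omega>) ` K) \<longleftrightarrow> (\<exists>y\<in>D. \<forall>k\<in>K. 0 < y \<bullet> S k \<omega>)" for \<omega>
    by (rule zero_notin_hull_iff_separated[OF fin D(2)])
  then have "{\<omega> \<in> space M. 0 \<in> convex hull ((\<lambda>k. S k \<omega>) ` K)} =
      {\<omega> \<in> space M. \<not> (\<exists>y\<in>D. \<forall>k\<in>K. 0 < y \<bullet> S k \<omega>)}"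
    by blast
  also have "\<dots> \<in> sets M"
  proof (intro sets.sets_Collect_neg sets.sets_Collect_countable_Ex'[OF _ D(1)] sets.sets_Collect_countable_All'[OF _ countable_finite[OF fin]])
    fix y k assume "k \<in> K"
    note [measurable] = meas[OF this]
    show "{\<omega> \<in> space M. 0 < y \<bullet> S k \<omega>} \<in> sets M" by measurable
  qed
  finally show ?thesis .
qed

section \<open>General position\<close>

text \<open>Dual form of general position: \<open>L\<close> meets a flat of the braid arrangement with at most \<open>d + 1\<close>
  blocks only in the constant vectors.\<close>

definition generic :: "nat \<Rightarrow> 'i set \<Rightarrow> ('i \<Rightarrow> 'v::euclidean_space) \<Rightarrow> bool" where
  "generic d I x \<longleftrightarrow> finite I \<and> dim (x ` I) \<le> d \<and>
     (\<forall>z. (\<Sum>i\<in>I. z i *\<^sub>R x i) = 0 \<longrightarrow> card (z ` I) \<le> Suc d \<longrightarrow> (\<exists>c::real. \<forall>i\<in>I. z i = c))"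

text \<open>A list stands for the Weyl chamber on which \<open>z\<close> increases along it; these
  are the chambers met by the space of relations.\<close>

definition orderings :: "'i set \<Rightarrow> ('i \<Rightarrow> 'v::real_vector) \<Rightarrow> 'i list set" where
  "orderings I x = {xs \<in> permutations_of_set I.
     \<exists>z::'i \<Rightarrow> real. (\<Sum>i\<in>I. z i *\<^sub>R x i) = 0 \<and> sorted_wrt (\<lambda>a b. z a < z b) xs}"

lemma genericD:
  assumes "generic d I x" "(\<Sum>i\<in>I. z i *\<^sub>R x i) = 0" "card (z ` I) \<le> Suc d" "i \<in> I" "j \<in> I"
  shows "z i = z j"
  using assms unfolding generic_def by (metis (no_types, lifting))

lemma obtain_other_element:
  assumes "card I \<ge> 2" "a \<in> I"
  obtains b where "b \<in> I" "b \<noteq> a"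
proof -
  have "card (I - {a}) \<noteq> 0" using assms by simp
  then show thesis using that by (metis Diff_iff card.empty ex_in_conv singletonI)
qed

lemma orderings_inj_on:
  fixes z :: "'i \<Rightarrow> real"
  assumes "sorted_wrt (\<lambda>a b. z a < z b) xs"
  shows "inj_on z (set xs)"
proof (rule inj_onI)
  fix u v assume "u \<in> set xs" "v \<in> set xs" "z u = z v"
  then obtain i j where ij: "i < length xs" "j < length xs" "u = xs ! i" "v = xs ! j"
    by (metis in_set_conv_nth)
  with assms \<open>z u = z v\<close> show "u = v"
    by (metis sorted_wrt_nth_less linorder_neqE_nat less_irrefl)
qed

text \<open>A point of a chamber takes \<open>card I <= d + 1\<close> values, so general position
  forces it to be constant; yet it is injective on at least two indices.\<close>

lemma orderings_small:
  assumes "generic d I x" "card I \<ge> 2" "card I \<le> Suc d"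
  shows "orderings I x = {}"
proof (rule ccontr)
  assume "orderings I x \<noteq> {}"
  then obtain xs and z :: "_ \<Rightarrow> real" where xs: "set xs = I" and z: "(\<Sum>i\<in>I. z i *\<^sub>R x i) = 0"
    and s: "sorted_wrt (\<lambda>a b. z a < z b) xs"
    unfolding orderings_def permutations_of_set_def by auto
  have fin: "finite I" using assms(1) generic_def by auto
  have "card (z ` I) \<le> Suc d"
    using card_image_le[OF fin, of z] assms(3) by linarith
  moreover have "I \<noteq> {}" using assms(2) by auto
  then obtain i where "i \<in> I" by blast
  moreover obtain j where "j \<in> I" "j \<noteq> i"
    using obtain_other_element[OF assms(2) \<open>i \<in> I\<close>] .
  ultimately show False
    using genericD[OF assms(1) z] orderings_inj_on[OF s] xs by (meson inj_onD)
qed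

lemma ex_sorted_wrt_less:
  fixes xs :: "'i list"
  assumes "distinct xs"
  shows "\<exists>z::'i \<Rightarrow> real. sorted_wrt (\<lambda>a b. z a < z b) xs"
proof -
  define z where "z a = real (inv_into {..<length xs} ((!) xs) a)" for a
  have inj: "inj_on ((!) xs) {..<length xs}"
    using assms by (simp add: inj_on_nth)
  have "z (xs ! i) = real i" if "i < length xs" for i
    unfolding z_def using inv_into_f_f[OF inj, of i] that by simp
  then have "sorted_wrt (\<lambda>a b. z a < z b) xs"
    by (simp add: sorted_wrt_iff_nth_less)
  then show ?thesis by blast
qed

text \<open>In codimension 0 all vectors vanish, every \<open>z\<close> is a relation, and all
  chambers are met.\<close>

lemma card_orderings_0:
  assumes "generic 0 I x"
  shows "card (orderings I x) = fact (card I)"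
proof -
  have "x i = 0" if "i \<in> I" for i
    using assms that unfolding generic_def by (auto simp: dim_eq_0)
  then have "(\<Sum>i\<in>I. z i *\<^sub>R x i) = 0" for z by simp
  then have "orderings I x = permutations_of_set I"
    unfolding orderings_def using ex_sorted_wrt_less[OF permutations_of_setD(2)] by auto
  then show ?thesis
    using assms by (simp add: generic_def)
qed

section \<open>Linear relations and transversality to the walls\<close>

lemma linear_relation_exists:
  fixes x :: "'i \<Rightarrow> 'v::euclidean_space"
  assumes "finite K" "dim (x ` K) < card K"
  obtains v where "(\<Sum>i\<in>K. v i *\<^sub>R x i) = 0" "\<exists>i\<in>K. v i \<noteq> (0::real)"
proof (cases "inj_on x K")
  case True
  then have "card (x ` K) = card K" by (rule card_image)
  then have "dependent (x ` K)"
    using assms by (metis independent_card_le_dim finite_imageI dim_subset linorder_not_le subset_refl)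
  then obtain u where u: "\<exists>v\<in>x ` K. u v \<noteq> 0" "(\<Sum>v\<in>x ` K. u v *\<^sub>R v) = 0"
    using dependent_finite[of "x ` K"] assms(1) by auto
  show thesis
  proof (rule that[of "\<lambda>i. u (x i)"])
    show "(\<Sum>i\<in>K. u (x i) *\<^sub>R x i) = 0"
      using u(2) by (simp add: sum.reindex[OF True])
  qed (use u(1) in auto)
next
  case False
  then obtain i j where ij: "i \<in> K" "j \<in> K" "i \<noteq> j" "x i = x j"
    by (auto simp: inj_on_def)
  \<comment> \<open>A repeated vector gives the relation \<open>x i - x j = 0\<close>.\<close>
  define v where "v k = (if k = i then 1 else if k = j then - 1 else (0::real))" for k
  have "(\<Sum>k\<in>K. v k *\<^sub>R x k) = (\<Sum>k\<in>{i, j}. v k *\<^sub>R x k)"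
    using assms(1) ij by (intro sum.mono_neutral_right) (auto simp: v_def)
  also have "\<dots> = 0" using ij by (simp add: v_def)
  finally show thesis
    using that[of v] ij(1) by (metis v_def zero_neq_one)
qed

lemma card_image_support_le:
  assumes "finite I" "K \<subseteq> I" "\<And>i. i \<in> I - K \<Longrightarrow> z i = c"
  shows "card (z ` I) \<le> Suc (card K)"
proof -
  have "z ` I \<subseteq> insert c (z ` K)" using assms by auto
  moreover have "finite K" using assms finite_subset by blast
  ultimately have "card (z ` I) \<le> card (insert c (z ` K))"
    by (intro card_mono) auto
  also have "\<dots> \<le> Suc (card K)"
    using card_image_le[OF \<open>finite K\<close>, of z] card_insert_le_m1
    by (metis Suc_le_mono card_insert_if finite_imageI \<open>finite K\<close> le_SucI)
  finally show ?thesis .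
qed

text \<open>The relations are transversal to each wall \<open>z a = z b\<close>. The vector at
  \<open>a\<close> and \<open>d\<close> others, avoiding \<open>b\<close>, are too many for
  dimension \<open>d\<close>, hence dependent; general position makes the coefficient at
  \<open>a\<close> nonzero, so it can be scaled to 1.\<close>

lemma generic_separate:
  assumes g: "generic d I x" and "card I \<ge> d + 2" and "a \<in> I" "b \<in> I" "a \<noteq> b"
  obtains v where "(\<Sum>i\<in>I. v i *\<^sub>R x i) = 0" "v a = 1" "v b = (0::real)"
proof -
  have fin: "finite I" and dm: "dim (x ` I) \<le> d" using g by (auto simp: generic_def)
  have "card (I - {a, b}) \<ge> d"
    using assms by (simp add: card_Diff_subset)
  then obtain J where J: "J \<subseteq> I - {a, b}" "card J = d" "finite J"
    by (meson fin finite_Diff obtain_subset_with_card_n)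
  let ?K = "insert a J"
  have K: "?K \<subseteq> I" "finite ?K" "card ?K = Suc d"
    using J assms by (auto simp: card_insert_if subset_iff)
  have "dim (x ` ?K) < card ?K"
    using dim_subset[of "x ` ?K" "x ` I"] K dm by (simp add: image_mono le_imp_less_Suc)
  then obtain u where u: "(\<Sum>i\<in>?K. u i *\<^sub>R x i) = 0" "\<exists>i\<in>?K. u i \<noteq> (0::real)"
    using linear_relation_exists K(2) by blast
  define v where "v i = (if i \<in> ?K then u i else 0)" for i
  have s: "(\<Sum>i\<in>I. v i *\<^sub>R x i) = 0"
  proof -
    have "(\<Sum>i\<in>I. v i *\<^sub>R x i) = (\<Sum>i\<in>?K. v i *\<^sub>R x i)"
      using fin K by (intro sum.mono_neutral_right) (auto simp: v_def)
    also have "\<dots> = (\<Sum>i\<in>?K. u i *\<^sub>R x i)" by (intro sum.cong) (auto simp: v_def)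
    finally show ?thesis using u by simp
  qed
  have vb: "v b = 0" using J assms by (auto simp: v_def)
  \<comment> \<open>Otherwise \<open>v\<close> lives on the \<open>d\<close> indices of
    \<open>J\<close> and takes at most \<open>d + 1\<close> values, so it is constant, equal to
    \<open>v b = 0\<close>, against the choice of \<open>u\<close>.\<close>
  have "v a \<noteq> 0"
  proof
    assume a0: "v a = 0"
    have "card (v ` I) \<le> Suc (card J)"
      by (rule card_image_support_le[where c = 0]) (use fin J a0 in \<open>auto simp: v_def\<close>)
    then have "v i = v b" if "i \<in> I" for i
      using genericD[OF g s _ that \<open>b \<in> I\<close>] J by simp
    then have "v i = 0" if "i \<in> ?K" for i
      using vb K(1) that by auto
    then show False using u(2) by (auto simp: v_def)
  qed
  show thesis
  proof (rule that[of "\<lambda>i. v i / v a"])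
    have "(\<Sum>i\<in>I. (v i / v a) *\<^sub>R x i) = (1 / v a) *\<^sub>R (\<Sum>i\<in>I. v i *\<^sub>R x i)"
      by (simp add: scaleR_sum_right)
    then show "(\<Sum>i\<in>I. (v i / v a) *\<^sub>R x i) = 0" using s by simp
  qed (use vb \<open>v a \<noteq> 0\<close> in auto)
qed

section \<open>Merging two indices and projecting along a vector\<close>

definition merge :: "'i \<Rightarrow> ('i \<Rightarrow> 'v::real_vector) \<Rightarrow> 'i \<Rightarrow> 'i \<Rightarrow> 'v" where
  "merge a x b = x(b := x b + x a)"

text \<open>Orthogonal projection to the complement of \<open>w\<close>; since division by zero
  yields zero, it is the identity for \<open>w = 0\<close>.\<close>

definition reject :: "'v::real_inner \<Rightarrow> 'v \<Rightarrow> 'v" where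
  "reject w v = v - (v \<bullet> w / (w \<bullet> w)) *\<^sub>R w"

lemma linear_reject: "linear (reject w)"
  unfolding reject_def
  by (rule linearI) (simp_all add: inner_add_left add_divide_distrib algebra_simps)

lemma reject_self [simp]: "reject w w = 0"
  by (cases "w = 0") (simp_all add: reject_def)

lemma sum_merge:
  assumes "finite J" "a \<notin> J" "b \<in> J" "z a = z b"
  shows "(\<Sum>i\<in>J. z i *\<^sub>R merge a x b i) = (\<Sum>i\<in>insert a J. z i *\<^sub>R x i)"
proof -
  have "(\<Sum>i\<in>J. z i *\<^sub>R merge a x b i) = (\<Sum>i\<in>J. z i *\<^sub>R x i + (if i = b then z b *\<^sub>R x a else 0))"
    by (intro sum.cong) (auto simp: merge_def scaleR_add_right)
  also have "\<dots> = (\<Sum>i\<in>J. z i *\<^sub>R x i) + z b *\<^sub>R x a"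
    using assms by (simp add: sum.distrib)
  finally show ?thesis using assms by (simp add: algebra_simps)
qed

text \<open>Giving \<open>a\<close> the value at \<open>b\<close> turns a relation of the merged
  family into one of the original family with the same set of values, so the bound
  \<open>d + 1\<close> carries over.\<close>

lemma generic_merge:
  assumes g: "generic d (insert a J) x" and "a \<notin> J" "b \<in> J"
  shows "generic d J (merge a x b)"
  unfolding generic_def
proof (intro conjI allI impI)
  show fin: "finite J" using g by (simp add: generic_def)
  have "merge a x b ` J \<subseteq> span (x ` insert a J)"
    using assms(3) by (auto simp: merge_def intro: span_base span_add)
  then have "dim (merge a x b ` J) \<le> dim (x ` insert a J)"
    by (metis dim_mono)
  then show "dim (merge a x b ` J) \<le> d" using g by (auto simp: generic_def)
  fix z :: "'a \<Rightarrow> real"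
  assume z: "(\<Sum>i\<in>J. z i *\<^sub>R merge a x b i) = 0" and c: "card (z ` J) \<le> Suc d"
  define y where "y = z(a := z b)"
  have yz: "y i = z i" if "i \<in> J" for i using that assms(2) by (auto simp: y_def)
  have "(\<Sum>i\<in>insert a J. y i *\<^sub>R x i) = (\<Sum>i\<in>J. y i *\<^sub>R merge a x b i)"
    by (rule sum_merge[symmetric]) (use fin assms in \<open>auto simp: y_def\<close>)
  also have "\<dots> = 0" using z yz by simp
  finally have s: "(\<Sum>i\<in>insert a J. y i *\<^sub>R x i) = 0" .
  have "y ` insert a J = z ` J"
    using assms by (auto simp: y_def)
  then have "y i = y b" if "i \<in> J" for i
    using genericD[OF g s, of i b] c that assms by simp
  then show "\<exists>c. \<forall>i\<in>J. z i = c" using yz assms(3) by metis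
qed

text \<open>The kernel of the projection is the line through \<open>x a\<close>, so a relation of
  the projected vectors is one that extends to \<open>a\<close> by some coefficient
  \<open>c\<close>.\<close>

lemma reject_relation:
  assumes "finite J" "a \<notin> J"
  shows "(\<Sum>i\<in>J. z i *\<^sub>R reject (x a) (x i)) = 0 \<longleftrightarrow>
    (\<exists>c. (\<Sum>i\<in>insert a J. (z(a := c)) i *\<^sub>R x i) = 0)"
proof -
  interpret linear "reject (x a)" by (rule linear_reject)
  have eq: "(\<Sum>i\<in>insert a J. (z(a := c)) i *\<^sub>R x i) = c *\<^sub>R x a + (\<Sum>i\<in>J. z i *\<^sub>R x i)" for c
  proof -
    have "(\<Sum>i\<in>J. (z(a := c)) i *\<^sub>R x i) = (\<Sum>i\<in>J. z i *\<^sub>R x i)"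
      using assms by (intro sum.cong) auto
    then show ?thesis using assms by simp
  qed
  define w where "w = (\<Sum>i\<in>J. z i *\<^sub>R x i)"
  have r: "(\<Sum>i\<in>J. z i *\<^sub>R reject (x a) (x i)) = reject (x a) w"
    by (simp add: w_def sum scale)
  have "reject (x a) w = 0 \<longleftrightarrow> (\<exists>c. c *\<^sub>R x a + w = 0)"
  proof
    assume "reject (x a) w = 0"
    then have "(- (w \<bullet> x a / (x a \<bullet> x a))) *\<^sub>R x a + w = 0" by (simp add: reject_def)
    then show "\<exists>c. c *\<^sub>R x a + w = 0" by blast
  next
    assume "\<exists>c. c *\<^sub>R x a + w = 0"
    then obtain c where "w = (- c) *\<^sub>R x a" by (metis add.commute eq_neg_iff_add_eq_0 scaleR_minus_left)
    then show "reject (x a) w = 0" by (simp only: scale reject_self) simp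
  qed
  then show ?thesis using eq r w_def by simp
qed

text \<open>The nonzero vector \<open>x a\<close> is orthogonal to the projected vectors, hence
  outside their span, and adds one dimension.\<close>

lemma dim_reject:
  assumes "x a \<noteq> (0::'v::euclidean_space)"
  shows "Suc (dim ((\<lambda>i. reject (x a) (x i)) ` J)) \<le> dim (x ` insert a J)"
proof -
  let ?R = "(\<lambda>i. reject (x a) (x i)) ` J"
  have orth: "v \<bullet> x a = 0" if "v \<in> span ?R" for v
  proof -
    have "orthogonal (x a) v"
      by (rule orthogonal_to_span[OF that])
         (use assms in \<open>auto simp: orthogonal_def reject_def inner_diff_right inner_commute\<close>)
    then show ?thesis by (simp add: orthogonal_def inner_commute)
  qed
  then have "x a \<notin> span ?R" using assms by fastforce
  then have "Suc (dim ?R) = dim (insert (x a) ?R)" by (simp add: dim_insert)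
  also have "\<dots> \<le> dim (x ` insert a J)"
  proof (rule dim_mono)
    show "insert (x a) ?R \<subseteq> span (x ` insert a J)"
      unfolding reject_def by (auto intro!: span_diff span_scale intro: span_base)
  qed
  finally show ?thesis .
qed

text \<open>If \<open>x a\<close> vanished, the indicator of \<open>a\<close> would be a nonconstant
  relation with only two values.\<close>

lemma generic_nonzero:
  assumes g: "generic (Suc d) I x" and "a \<in> I" "card I \<ge> 2"
  shows "x a \<noteq> 0"
proof
  assume a: "x a = 0"
  have fin: "finite I" using g by (simp add: generic_def)
  define z :: "_ \<Rightarrow> real" where "z i = (if i = a then 1 else 0)" for i
  have s: "(\<Sum>i\<in>I. z i *\<^sub>R x i) = 0" using a by (intro sum.neutral) (auto simp: z_def)
  have c: "card (z ` I) \<le> Suc (Suc d)"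
    using card_image_support_le[OF fin, of "{a}" z 0] assms(2) by (auto simp: z_def)
  obtain b where b: "b \<in> I" "b \<noteq> a"
    using obtain_other_element[OF assms(3,2)] .
  show False using genericD[OF g s c assms(2) b(1)] b by (simp add: z_def)
qed

text \<open>The coefficient at \<open>a\<close> adds at most one value to those on \<open>J\<close>,
  which matches the admissible number growing from \<open>d + 1\<close> to
  \<open>d + 2\<close>.\<close>

lemma generic_reject:
  assumes g: "generic (Suc d) (insert a J) x" and aJ: "a \<notin> J" and J: "card J \<ge> 1"
  shows "generic d J (\<lambda>i. reject (x a) (x i))"
  unfolding generic_def
proof (intro conjI allI impI)
  show fin: "finite J" using g by (simp add: generic_def)
  have "x a \<noteq> 0" using generic_nonzero[OF g] fin aJ J by simp
  from dim_reject[of x a J, OF this] show "dim ((\<lambda>i. reject (x a) (x i)) ` J) \<le> d"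
    using g by (auto simp: generic_def)
  fix z :: "'a \<Rightarrow> real"
  assume z: "(\<Sum>i\<in>J. z i *\<^sub>R reject (x a) (x i)) = 0" and c: "card (z ` J) \<le> Suc d"
  from z obtain c where s: "(\<Sum>i\<in>insert a J. (z(a := c)) i *\<^sub>R x i) = 0"
    using reject_relation[OF fin aJ] by blast
  have "card ((z(a := c)) ` insert a J) \<le> Suc (Suc d)"
  proof -
    have "(z(a := c)) ` insert a J \<subseteq> insert c (z ` J)" by auto
    then have "card ((z(a := c)) ` insert a J) \<le> card (insert c (z ` J))"
      using fin by (intro card_mono) auto
    also have "\<dots> \<le> Suc (card (z ` J))" using fin by (simp add: card_insert_if)
    finally show ?thesis using c by simp
  qed
  note const = genericD[OF g s this]
  show "\<exists>c. \<forall>i\<in>J. z i = c"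
  proof (intro exI ballI)
    fix i assume "i \<in> J"
    then show "z i = c" using const[of i a] aJ by (auto split: if_splits)
  qed
qed

section \<open>Insertion of an index\<close>

lemma sorted_wrt_insert_at:
  "sorted_wrt R (take p ys @ a # drop p ys) \<longleftrightarrow>
     sorted_wrt R ys \<and> (\<forall>u\<in>set (take p ys). R u a) \<and> (\<forall>u\<in>set (drop p ys). R a u)"
  unfolding sorted_wrt_append[of R "take p ys" "drop p ys", unfolded append_take_drop_id]
    sorted_wrt_append sorted_wrt.simps by auto

lemma bij_betw_insert_at:
  assumes "finite J" "a \<notin> J"
  shows "bij_betw (\<lambda>(ys, p). take p ys @ a # drop p ys)
    (permutations_of_set J \<times> {..card J}) (permutations_of_set (insert a J))"
proof (rule bij_betwI')
  have len: "length ys = card J" "set ys = J" "distinct ys" if "ys \<in> permutations_of_set J" for ys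
    using that by (auto simp: length_finite_permutations_of_set permutations_of_setD)
  {
    fix s t
    assume s: "s \<in> permutations_of_set J \<times> {..card J}" and t: "t \<in> permutations_of_set J \<times> {..card J}"
    obtain ys p zs q where st: "s = (ys, p)" "t = (zs, q)" by fastforce
    have *: "a \<notin> set ys" "a \<notin> set zs" "p \<le> length ys" "q \<le> length zs"
      using s t st len assms by auto
    show "(case s of (ys, p) \<Rightarrow> take p ys @ a # drop p ys) =
          (case t of (ys, p) \<Rightarrow> take p ys @ a # drop p ys) \<longleftrightarrow> s = t"
    proof
      assume "(case s of (ys, p) \<Rightarrow> take p ys @ a # drop p ys) =
          (case t of (ys, p) \<Rightarrow> take p ys @ a # drop p ys)"
      then have "take p ys @ a # drop p ys = take q zs @ a # drop q zs" using st by simp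
      then have e: "take p ys = take q zs" "drop p ys = drop q zs"
        using append_Cons_eq_iff[of a "take p ys" "drop p ys" "take q zs" "drop q zs"]
          * in_set_takeD[of a p ys] in_set_dropD[of a p ys] by blast+
      then have "ys = zs" by (metis append_take_drop_id)
      moreover have "p = q" using e(1) * by (metis length_take min.absorb2)
      ultimately show "s = t" using st by simp
    qed simp
  next
    fix s assume s: "s \<in> permutations_of_set J \<times> {..card J}"
    obtain ys p where st: "s = (ys, p)" by fastforce
    have *: "set ys = J" "distinct ys" using s st len by auto
    have "distinct (take p ys @ drop p ys)" using * by simp
    then have "distinct (take p ys @ a # drop p ys)"
      using * assms unfolding distinct_append by (auto dest: in_set_takeD in_set_dropD)
    moreover have "set (take p ys @ a # drop p ys) = insert a (set (take p ys @ drop p ys))"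
      by (simp only: set_append list.set Un_insert_right)
    then have "set (take p ys @ a # drop p ys) = insert a J"
      by (simp only: append_take_drop_id *)
    ultimately show "(case s of (ys, p) \<Rightarrow> take p ys @ a # drop p ys) \<in> permutations_of_set (insert a J)"
      unfolding st prod.case by (intro permutations_of_setI)
  next
    fix xs assume "xs \<in> permutations_of_set (insert a J)"
    then have xs: "set xs = insert a J" "distinct xs" by (auto simp: permutations_of_setD)
    then obtain us vs where uv: "xs = us @ a # vs" by (metis insertI1 split_list)
    have "us @ vs \<in> permutations_of_set J"
      using xs uv assms by (intro permutations_of_setI) auto
    moreover have "length us \<le> card J"
      using len[OF calculation] by simp
    ultimately show "\<exists>s\<in>permutations_of_set J \<times> {..card J}.
        xs = (case s of (ys, p) \<Rightarrow> take p ys @ a # drop p ys)"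
      using uv by (intro bexI[of _ "(us @ vs, length us)"]) auto
  }
qed

text \<open>Applied with \<open>A\<close> the positions at which an index can be inserted into an ordering and \<open>B\<close> the
  walls that are met.\<close>

lemma card_interval_adjacent:
  fixes A :: "nat set"
  assumes "finite A" "A \<noteq> {}" and conv: "\<And>p q r. p \<in> A \<Longrightarrow> q \<in> A \<Longrightarrow> p \<le> r \<Longrightarrow> r < q \<Longrightarrow> r \<in> B"
    and B: "\<And>r. r \<in> B \<Longrightarrow> r \<in> A \<and> Suc r \<in> A"
  shows "card A = Suc (card B)"
proof -
  \<comment> \<open>Every number from \<open>Min A\<close> up to but excluding \<open>Max A\<close>
    lies in \<open>B\<close> and hence in \<open>A\<close>. So \<open>A\<close> is a full interval,
    and \<open>B\<close> turns out to be this interval without its last element.\<close>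
  have A': "A = {Min A..Max A}"
  proof
    show "{Min A..Max A} \<subseteq> A"
    proof
      fix r assume "r \<in> {Min A..Max A}"
      then show "r \<in> A"
        using conv[of "Min A" "Max A" r] B[of r] assms(1,2) by (cases "r = Max A") simp_all
    qed
    show "A \<subseteq> {Min A..Max A}" using assms(1) by auto
  qed
  have "B = {Min A..<Max A}"
  proof
    show "B \<subseteq> {Min A..<Max A}"
    proof
      fix r assume "r \<in> B"
      then have "r \<in> A" "Suc r \<in> A" using B[of r] by simp_all
      then have "Min A \<le> r" "Suc r \<le> Max A" using assms(1) by auto
      then show "r \<in> {Min A..<Max A}" by simp
    qed
    show "{Min A..<Max A} \<subseteq> B" using conv[of "Min A" "Max A"] assms(1,2) by auto
  qed
  moreover have "Min A \<le> Max A" using assms(1,2) by simp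
  ultimately show ?thesis using arg_cong[OF A', of card] by simp
qed

section \<open>Perturbation into a chamber\<close>

lemma eventually_perturbed_pos:
  fixes a b :: real
  assumes "0 < a \<or> a = 0 \<and> 0 < b"
  shows "eventually (\<lambda>e. 0 < a + e * b) (at_right 0)"
  using assms
proof
  assume "0 < a"
  moreover have "((\<lambda>e. a + e * b) \<longlongrightarrow> a + 0 * b) (at_right 0)"
    by (intro tendsto_intros)
  ultimately show ?thesis by (intro order_tendstoD(1)) auto
next
  assume *: "a = 0 \<and> 0 < b"
  show ?thesis
    using eventually_at_right_less[of "0::real"] by eventually_elim (simp add: *)
qed

text \<open>For small \<open>e > 0\<close>, \<open>z + e * v\<close> orders indices as
  \<open>z\<close> does with ties broken by \<open>v\<close>; only finitely many comparisons are
  involved, so one \<open>e\<close> serves all.\<close>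

lemma sorted_wrt_perturb:
  fixes z v :: "'i \<Rightarrow> real"
  assumes "sorted_wrt (\<lambda>a b. z a < z b \<or> z a = z b \<and> v a < v b) xs"
  shows "\<exists>e>0. sorted_wrt (\<lambda>a b. z a + e * v a < z b + e * v b) xs"
proof -
  have "eventually (\<lambda>e. z a + e * v a < z b + e * v b) (at_right 0)"
    if "z a < z b \<or> z a = z b \<and> v a < v b" for a b
    using eventually_perturbed_pos[of "z b - z a" "v b - v a"] that by (auto simp: algebra_simps)
  then have *: "eventually (\<lambda>e. \<forall>j\<in>{..<length xs}. \<forall>i\<in>{..<j}.
      z (xs ! i) + e * v (xs ! i) < z (xs ! j) + e * v (xs ! j)) (at_right 0)"
    using assms by (intro eventually_ball_finite ballI) (simp_all add: sorted_wrt_iff_nth_less)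
  have "eventually (\<lambda>e. 0 < e \<and> sorted_wrt (\<lambda>a b. z a + e * v a < z b + e * v b) xs) (at_right 0)"
    using * eventually_at_right_less[of "0::real"]
    by eventually_elim (simp add: sorted_wrt_iff_nth_less)
  then show ?thesis
    using eventually_happens' trivial_limit_at_right_real by blast
qed

lemma sorted_wrt_fun_upd:
  assumes "a \<notin> set ys"
  shows "sorted_wrt (\<lambda>u v. (z(a := c)) u < (z(a := c)) v) ys \<longleftrightarrow> sorted_wrt (\<lambda>u v. z u < z v) ys"
  using assms by (induction ys) auto

lemma set_drop_nth: "set (drop p ys) = (!) ys ` {p..<length ys}"
proof -
  have "drop p ys = map ((!) ys) [p..<length ys]" by (rule nth_equalityI) auto
  then show ?thesis by simp
qed

lemma set_take_nth: "p \<le> length ys \<Longrightarrow> set (take p ys) = (!) ys ` {..<p}"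
  by (simp add: nth_image lessThan_atLeast0)

lemma insert_at_in_permutations:
  assumes "finite J" "a \<notin> J" "ys \<in> permutations_of_set J" "p \<le> card J"
  shows "take p ys @ a # drop p ys \<in> permutations_of_set (insert a J)"
  using bij_betwE[OF bij_betw_insert_at[OF assms(1,2)], rule_format, of "(ys, p)"] assms(3,4)
  by simp

lemma orderings_insert_at_iff:
  assumes "finite J" "a \<notin> J" "ys \<in> permutations_of_set J" "p \<le> card J"
  shows "take p ys @ a # drop p ys \<in> orderings (insert a J) x \<longleftrightarrow>
    (\<exists>z. (\<Sum>i\<in>insert a J. z i *\<^sub>R x i) = 0 \<and> sorted_wrt (\<lambda>u v. z u < z v) ys \<and>
       (\<forall>i<p. z (ys ! i) < z a) \<and> (\<forall>i\<in>{p..<card J}. z a < z (ys ! i)))"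
proof -
  have len: "length ys = card J" using assms(3) by (simp add: length_finite_permutations_of_set)
  have "take p ys @ a # drop p ys \<in> permutations_of_set (insert a J)"
    by (rule insert_at_in_permutations[OF assms])
  moreover have "set (take p ys) = (!) ys ` {..<p}"
    by (rule set_take_nth) (simp only: len assms(4))
  moreover have "set (drop p ys) = (!) ys ` {p..<card J}"
    by (simp only: set_drop_nth len)
  ultimately show ?thesis
    unfolding orderings_def by (simp add: sorted_wrt_insert_at) (simp add: Ball_def)
qed

text \<open>Relations of the merged family are the original relations on the wall
  \<open>z a = z b\<close>, so membership says that this wall is met above the chamber of
  \<open>ys\<close>.\<close>

lemma orderings_merge_iff:
  assumes "finite J" "a \<notin> J" "ys \<in> permutations_of_set J" "b \<in> J"
  shows "ys \<in> orderings J (merge a x b) \<longleftrightarrow>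
    (\<exists>z. (\<Sum>i\<in>insert a J. z i *\<^sub>R x i) = 0 \<and> sorted_wrt (\<lambda>u v. z u < z v) ys \<and> z a = z b)"
proof
  assume "ys \<in> orderings J (merge a x b)"
  then obtain z where z: "(\<Sum>i\<in>J. z i *\<^sub>R merge a x b i) = 0" "sorted_wrt (\<lambda>u v. z u < z v) ys"
    by (auto simp: orderings_def)
  define y where "y = z(a := z b)"
  have ab: "y a = y b" using assms by (auto simp: y_def)
  have "(\<Sum>i\<in>J. y i *\<^sub>R merge a x b i) = (\<Sum>i\<in>J. z i *\<^sub>R merge a x b i)"
    using assms by (intro sum.cong) (auto simp: y_def)
  then have "(\<Sum>i\<in>insert a J. y i *\<^sub>R x i) = 0"
    using z(1) sum_merge[OF assms(1,2,4), of y x] ab by simp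
  moreover have "sorted_wrt (\<lambda>u v. y u < y v) ys"
    unfolding y_def using sorted_wrt_fun_upd[of a ys z "z b"] z(2) assms by (simp add: permutations_of_setD)
  ultimately show "\<exists>z. (\<Sum>i\<in>insert a J. z i *\<^sub>R x i) = 0 \<and> sorted_wrt (\<lambda>u v. z u < z v) ys \<and> z a = z b"
    using ab by blast
next
  assume "\<exists>z. (\<Sum>i\<in>insert a J. z i *\<^sub>R x i) = 0 \<and> sorted_wrt (\<lambda>u v. z u < z v) ys \<and> z a = z b"
  then obtain z where "(\<Sum>i\<in>insert a J. z i *\<^sub>R x i) = 0" "sorted_wrt (\<lambda>u v. z u < z v) ys" "z a = z b"
    by blast
  then show "ys \<in> orderings J (merge a x b)"
    using sum_merge[OF assms(1,2,4), of z x] assms(3) by (auto simp: orderings_def)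
qed

text \<open>Projecting along \<open>x a\<close> leaves the value at \<open>a\<close> free, so
  membership says that some relation lies above the chamber of \<open>ys\<close>.\<close>

lemma orderings_reject_iff:
  assumes "finite J" "a \<notin> J" "ys \<in> permutations_of_set J"
  shows "ys \<in> orderings J (\<lambda>i. reject (x a) (x i)) \<longleftrightarrow>
    (\<exists>z. (\<Sum>i\<in>insert a J. z i *\<^sub>R x i) = 0 \<and> sorted_wrt (\<lambda>u v. z u < z v) ys)"
proof -
  have a: "a \<notin> set ys" using assms by (simp add: permutations_of_setD)
  have "ys \<in> orderings J (\<lambda>i. reject (x a) (x i)) \<longleftrightarrow>
    (\<exists>z c. (\<Sum>i\<in>insert a J. (z(a := c)) i *\<^sub>R x i) = 0 \<and> sorted_wrt (\<lambda>u v. z u < z v) ys)"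
    unfolding orderings_def mem_Collect_eq reject_relation[OF assms(1,2)] using assms(3) by blast
  also have "\<dots> \<longleftrightarrow> (\<exists>z c. (\<Sum>i\<in>insert a J. (z(a := c)) i *\<^sub>R x i) = 0 \<and>
      sorted_wrt (\<lambda>u v. (z(a := c)) u < (z(a := c)) v) ys)"
    unfolding sorted_wrt_fun_upd[OF a] ..
  also have "\<dots> \<longleftrightarrow> (\<exists>z. (\<Sum>i\<in>insert a J. z i *\<^sub>R x i) = 0 \<and> sorted_wrt (\<lambda>u v. z u < z v) ys)"
  proof
    assume "\<exists>z. (\<Sum>i\<in>insert a J. z i *\<^sub>R x i) = 0 \<and> sorted_wrt (\<lambda>u v. z u < z v) ys"
    then obtain z where "(\<Sum>i\<in>insert a J. z i *\<^sub>R x i) = 0 \<and> sorted_wrt (\<lambda>u v. z u < z v) ys" ..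
    then show "\<exists>z c. (\<Sum>i\<in>insert a J. (z(a := c)) i *\<^sub>R x i) = 0 \<and>
        sorted_wrt (\<lambda>u v. (z(a := c)) u < (z(a := c)) v) ys"
      by (intro exI[of _ z] exI[of _ "z a"]) (simp only: fun_upd_triv)
  qed blast
  finally show ?thesis .
qed

text \<open>Above the chamber of \<open>ys\<close>, the walls \<open>z a = z (ys ! r)\<close> cut
  the relations into consecutive pieces, one more than the walls met. The \<open>of_bool\<close>
  term is this extra piece; it is 0 when no relation lies above the chamber.\<close>

lemma card_insertions:
  assumes g: "generic d (insert a J) x" and aJ: "a \<notin> J" and J: "card J \<ge> Suc d"
    and ys: "ys \<in> permutations_of_set J"
  shows "card {p \<in> {..card J}. take p ys @ a # drop p ys \<in> orderings (insert a J) x} =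
     card {r \<in> {..<card J}. ys \<in> orderings J (merge a x (ys ! r))} +
     of_bool (ys \<in> orderings J (\<lambda>i. reject (x a) (x i)))" (is "card ?A = card ?B + _")
proof -
  have fin: "finite J" using g by (simp add: generic_def)
  let ?m = "card J" and ?I = "insert a J"
  let ?rel = "\<lambda>z. (\<Sum>i\<in>?I. z i *\<^sub>R x i) = 0 \<and> sorted_wrt (\<lambda>u v. z u < z v) ys"
  have len: "length ys = ?m" and set: "set ys = J"
    using length_finite_permutations_of_set[OF ys] permutations_of_setD[OF ys] by auto
  have A: "p \<in> ?A \<longleftrightarrow> p \<le> ?m \<and>
      (\<exists>z. ?rel z \<and> (\<forall>i<p. z (ys ! i) < z a) \<and> (\<forall>i\<in>{p..<?m}. z a < z (ys ! i)))" for p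
    using orderings_insert_at_iff[OF fin aJ ys, of p x] by auto
  have nthJ: "ys ! r \<in> J" if "r < ?m" for r using that len set by (metis nth_mem)
  have B: "r \<in> ?B \<longleftrightarrow> r < ?m \<and> (\<exists>z. ?rel z \<and> z a = z (ys ! r))" for r
    using orderings_merge_iff[OF fin aJ ys, of "ys ! r" x] nthJ[of r] by auto
  have mono: "z (ys ! i) < z (ys ! j)" if "?rel z" "i < j" "j < ?m" for z :: "_ \<Rightarrow> real" and i j
    using that len by (simp add: sorted_wrt_iff_nth_less)
  have fA: "finite ?A" by simp
  \<comment> \<open>\<open>z a - z (ys ! r)\<close> has opposite signs at the two points, so it vanishes on the segment
    joining them.\<close>
  have conv: "r \<in> ?B" if p: "p \<in> ?A" and q: "q \<in> ?A" and r: "p \<le> r" "r < q" for p q r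
  proof -
    obtain y where y: "?rel y" "\<forall>i\<in>{p..<?m}. y a < y (ys ! i)" using p unfolding A by blast
    obtain z where z: "?rel z" "\<forall>i<q. z (ys ! i) < z a" and qm: "q \<le> ?m" using q unfolding A by blast
    \<comment> \<open>The weights are crossed: in \<open>s * y + t * z\<close> the difference
      between \<open>a\<close> and \<open>ys ! r\<close> is
      \<open>s * (- t) + t * s = 0\<close>.\<close>
    define s where "s = z a - z (ys ! r)"
    define t where "t = y (ys ! r) - y a"
    have st: "s > 0" "t > 0" using y(2) z(2) r qm by (auto simp: s_def t_def)
    define w where "w i = s * y i + t * z i" for i
    have "(\<Sum>i\<in>?I. w i *\<^sub>R x i) = s *\<^sub>R (\<Sum>i\<in>?I. y i *\<^sub>R x i) + t *\<^sub>R (\<Sum>i\<in>?I. z i *\<^sub>R x i)"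
      by (simp only: w_def scaleR_add_left sum.distrib scaleR_sum_right scaleR_scaleR)
    then have "(\<Sum>i\<in>?I. w i *\<^sub>R x i) = 0" using y(1) z(1) by simp
    moreover have "sorted_wrt (\<lambda>u v. w u < w v) ys"
      using y(1) z(1) st by (auto simp: sorted_wrt_iff_nth_less w_def add_strict_mono)
    moreover have "w a = w (ys ! r)" by (simp add: w_def s_def t_def algebra_simps)
    moreover have "r < ?m" using r qm by simp
    ultimately show ?thesis unfolding B by blast
  qed
  \<comment> \<open>\<open>L\<close> is transversal to the wall, so it can be left on either side.\<close>
  have adj: "r \<in> ?A \<and> Suc r \<in> ?A" if r: "r \<in> ?B" for r
  proof -
    obtain z where z: "?rel z" "z a = z (ys ! r)" and rm: "r < ?m" using r unfolding B by blast
    have ab: "a \<noteq> ys ! r" using nthJ[OF rm] aJ by auto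
    have perturb: "take p ys @ a # drop p ys \<in> orderings ?I x"
      if p: "p \<le> ?m" and v: "(\<Sum>i\<in>?I. v i *\<^sub>R x i) = 0"
        and s: "sorted_wrt (\<lambda>u w. z u < z w \<or> z u = z w \<and> v u < v w) (take p ys @ a # drop p ys)"
      for p v
    proof -
      obtain e where e: "e > 0"
        "sorted_wrt (\<lambda>u w. z u + e * v u < z w + e * v w) (take p ys @ a # drop p ys)"
        using sorted_wrt_perturb[OF s] by blast
      have "(\<Sum>i\<in>?I. (z i + e * v i) *\<^sub>R x i) = (\<Sum>i\<in>?I. z i *\<^sub>R x i) + e *\<^sub>R (\<Sum>i\<in>?I. v i *\<^sub>R x i)"
        by (simp only: scaleR_add_left sum.distrib scaleR_sum_right scaleR_scaleR)
      then have "(\<Sum>i\<in>?I. (z i + e * v i) *\<^sub>R x i) = 0" using z v by simp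
      moreover have "take p ys @ a # drop p ys \<in> permutations_of_set ?I"
        by (rule insert_at_in_permutations[OF fin aJ ys p])
      ultimately show ?thesis
        unfolding orderings_def mem_Collect_eq using e(2) by (intro conjI exI[of _ "\<lambda>i. z i + e * v i"])
    qed
    have card: "card ?I \<ge> d + 2" using J fin aJ by simp
    have I: "a \<in> ?I" "ys ! r \<in> ?I" using nthJ[OF rm] by auto
    have zs: "z (ys ! i) < z (ys ! r)" if "i < r" for i using mono[OF z(1) that rm] .
    have zl: "z (ys ! r) < z (ys ! i)" if "r < i" "i < ?m" for i using mono[OF z(1) that] .
    have sortz: "sorted_wrt (\<lambda>u w. z u < z w \<or> z u = z w \<and> v u < v w) ys" for v :: "_ \<Rightarrow> real"
      using z(1) by (auto simp: sorted_wrt_iff_nth_less)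
    have set_drop: "set (drop p ys) = (!) ys ` {p..<?m}" for p
      using set_drop_nth[of p ys] len by simp
    have set_take: "set (take p ys) = (!) ys ` {..<p}" if "p \<le> ?m" for p
      using set_take_nth[of p ys] len that by simp
    \<comment> \<open>This direction raises \<open>ys ! r\<close> relative to \<open>a\<close>, so
      \<open>a\<close> moves just before it, to position \<open>r\<close>.\<close>
    obtain v where v: "(\<Sum>i\<in>?I. v i *\<^sub>R x i) = 0" "v (ys ! r) = 1" "v a = 0"
      using generic_separate[OF g card I(2,1)] ab by metis
    have "take r ys @ a # drop r ys \<in> orderings ?I x"
    proof (rule perturb[OF _ v(1)])
      have "z a < z (ys ! i) \<or> z a = z (ys ! i) \<and> v a < v (ys ! i)" if "i \<in> {r..<?m}" for i
        using zl[of i] z(2) v that by (cases "i = r") auto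
      then show "sorted_wrt (\<lambda>u w. z u < z w \<or> z u = z w \<and> v u < v w) (take r ys @ a # drop r ys)"
        unfolding sorted_wrt_insert_at set_drop set_take[OF less_imp_le[OF rm]]
        using sortz zs z(2) by auto
    qed (use rm in simp)
    moreover
    \<comment> \<open>This direction raises \<open>a\<close> relative to \<open>ys ! r\<close>, so
      \<open>a\<close> moves just after it, to position \<open>Suc r\<close>.\<close>
    obtain v where v: "(\<Sum>i\<in>?I. v i *\<^sub>R x i) = 0" "v a = 1" "v (ys ! r) = 0"
      using generic_separate[OF g card I ab] .
    have "take (Suc r) ys @ a # drop (Suc r) ys \<in> orderings ?I x"
    proof (rule perturb[OF _ v(1)])
      have "z (ys ! i) < z a \<or> z (ys ! i) = z a \<and> v (ys ! i) < v a" if "i \<in> {..<Suc r}" for i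
        using zs[of i] z(2) v that by (cases "i = r") auto
      then show "sorted_wrt (\<lambda>u w. z u < z w \<or> z u = z w \<and> v u < v w)
          (take (Suc r) ys @ a # drop (Suc r) ys)"
        unfolding sorted_wrt_insert_at set_drop set_take[OF Suc_leI[OF rm]]
        using sortz zl z(2) by auto
    qed (use rm in simp)
    ultimately show ?thesis unfolding mem_Collect_eq using rm by simp
  qed
  have ne: "?A \<noteq> {} \<longleftrightarrow> ys \<in> orderings J (\<lambda>i. reject (x a) (x i))"
  proof
    assume "?A \<noteq> {}"
    then obtain p where "p \<in> ?A" by blast
    then show "ys \<in> orderings J (\<lambda>i. reject (x a) (x i))"
      unfolding A orderings_reject_iff[OF fin aJ ys] by blast
  next
    assume "ys \<in> orderings J (\<lambda>i. reject (x a) (x i))"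
    then obtain z where z: "?rel z" unfolding orderings_reject_iff[OF fin aJ ys] by blast
    show "?A \<noteq> {}"
    proof (cases "\<exists>r<?m. z a = z (ys ! r)")
      case True
      then have "\<exists>r. r \<in> ?B" unfolding B using z by blast
      then show ?thesis using adj by blast
    next
      case False
      \<comment> \<open>Off all walls, \<open>a\<close> goes before the first entry with a larger
        value; the disjunct \<open>?m <= i\<close> yields the end position if there is none.\<close>
      define P where "P i \<longleftrightarrow> ?m \<le> i \<or> z a < z (ys ! i)" for i
      define p where "p = (LEAST i. P i)"
      have "P ?m" by (simp add: P_def)
      then have pm: "p \<le> ?m" and Pp: "P p" unfolding p_def by (rule Least_le, rule LeastI)
      have "z (ys ! i) < z a" if "i < p" for i
      proof -
        have "\<not> P i" using not_less_Least that unfolding p_def .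
        then have "i < ?m" "z (ys ! i) \<le> z a" by (auto simp: P_def)
        moreover have "z (ys ! i) \<noteq> z a" using False \<open>i < ?m\<close> by metis
        ultimately show ?thesis by simp
      qed
      moreover have "z a < z (ys ! i)" if i: "i \<in> {p..<?m}" for i
        using Pp i mono[OF z, of p i] by (cases "i = p") (auto simp: P_def)
      ultimately have "p \<in> ?A" unfolding A using pm z by blast
      then show ?thesis by blast
    qed
  qed
  show ?thesis
  proof (cases "?A = {}")
    case True
    then have "?B = {}" using adj by blast
    moreover have "ys \<notin> orderings J (\<lambda>i. reject (x a) (x i))" using True ne by blast
    ultimately show ?thesis using True by (simp only: of_bool_eq card.empty simp_thms add_0)
  next
    case False
    have "card ?A = Suc (card ?B)"
      by (rule card_interval_adjacent[OF fA False conv adj])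
    moreover have "ys \<in> orderings J (\<lambda>i. reject (x a) (x i))" using False ne by blast
    ultimately show ?thesis by (simp only: of_bool_eq simp_thms Suc_eq_plus1)
  qed
qed

text \<open>Each ordering of \<open>insert a J\<close> is an ordering of \<open>J\<close> with an
  insertion position; the count of \<open>card_insertions\<close> is summed over all orderings of
  \<open>J\<close>.\<close>

lemma card_orderings_insert:
  fixes x :: "'i \<Rightarrow> 'v::euclidean_space"
  assumes g: "generic d (insert a J) x" and aJ: "a \<notin> J" and J: "card J \<ge> Suc d"
  shows "card (orderings (insert a J) x) =
    card (orderings J (\<lambda>i. reject (x a) (x i))) + (\<Sum>b\<in>J. card (orderings J (merge a x b)))"
proof -
  have fin: "finite J" using g by (simp add: generic_def)
  let ?P = "permutations_of_set J" and ?f = "\<lambda>(ys, p). take p ys @ a # drop p ys"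
  let ?A = "\<lambda>ys. {p \<in> {..card J}. take p ys @ a # drop p ys \<in> orderings (insert a J) x}"
  let ?R = "orderings J (\<lambda>i. reject (x a) (x i))"
  note bij = bij_betw_insert_at[OF fin aJ]
  have img: "orderings (insert a J) x = ?f ` (SIGMA ys:?P. ?A ys)"
  proof (intro equalityI subsetI)
    fix xs assume xs: "xs \<in> orderings (insert a J) x"
    then have "xs \<in> ?f ` (?P \<times> {..card J})"
      unfolding bij_betw_imp_surj_on[OF bij] by (simp add: orderings_def)
    then obtain ys p where "ys \<in> ?P" "p \<le> card J" "xs = take p ys @ a # drop p ys" by auto
    then show "xs \<in> ?f ` (SIGMA ys:?P. ?A ys)"
      using xs by (intro image_eqI[of _ _ "(ys, p)"]) simp_all
  qed auto
  have inj: "inj_on ?f (SIGMA ys:?P. ?A ys)"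
    by (rule inj_on_subset[OF bij_betw_imp_inj_on[OF bij]]) auto
  have sub: "ys \<in> ?P" if "ys \<in> orderings J y" for ys and y :: "'i \<Rightarrow> 'v" using that by (simp add: orderings_def)
  have "card (orderings (insert a J) x) = card (SIGMA ys:?P. ?A ys)"
    using arg_cong[OF img, of card] card_image[OF inj] by (rule trans)
  also have "\<dots> = (\<Sum>ys\<in>?P. card (?A ys))"
    by (rule card_SigmaI) simp_all
  also have "\<dots> = (\<Sum>ys\<in>?P. (\<Sum>b\<in>J. of_bool (ys \<in> orderings J (merge a x b))) + of_bool (ys \<in> ?R))"
  proof (rule sum.cong[OF refl])
    fix ys assume ys: "ys \<in> ?P"
    \<comment> \<open>\<open>ys\<close> enumerates \<open>J\<close>, so walls indexed by positions
      become walls indexed by elements \<open>b\<close>, and the two sums can be exchanged.\<close>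
    have "bij_betw ((!) ys) {..<card J} J"
      by (rule bij_betw_nth) (simp_all add: permutations_of_setD[OF ys] length_finite_permutations_of_set[OF ys])
    then have "(\<Sum>b\<in>J. of_bool (ys \<in> orderings J (merge a x b))) =
        (\<Sum>r<card J. of_bool (ys \<in> orderings J (merge a x (ys ! r))) :: nat)"
      by (rule sum.reindex_bij_betw[symmetric])
    then show "card (?A ys) = (\<Sum>b\<in>J. of_bool (ys \<in> orderings J (merge a x b))) + of_bool (ys \<in> ?R)"
      unfolding card_insertions[OF g aJ J ys] by (simp add: sum_of_bool_eq Collect_conj_eq lessThan_def)
  qed
  also have "\<dots> = (\<Sum>b\<in>J. \<Sum>ys\<in>?P. of_bool (ys \<in> orderings J (merge a x b))) + (\<Sum>ys\<in>?P. of_bool (ys \<in> ?R))"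
    by (simp only: sum.distrib) (subst sum.swap, rule refl)
  also have "\<dots> = (\<Sum>b\<in>J. card (orderings J (merge a x b))) + card ?R"
  proof -
    have "?P \<inter> orderings J y = orderings J y" for y :: "'i \<Rightarrow> 'v" using sub by blast
    then have "(\<Sum>ys\<in>?P. of_bool (ys \<in> orderings J y)) = card (orderings J y)" for y :: "'i \<Rightarrow> 'v"
      by (simp add: sum_of_bool_eq)
    then show ?thesis by simp
  qed
  finally show ?thesis by simp
qed

section \<open>The Stirling recurrence\<close>

text \<open>The bracketed sum of Stirling numbers in the theorem; under \<open>d + 2 <= k\<close>
  the natural subtraction \<open>k - d\<close> is exact.\<close>

definition stirling_tail :: "nat \<Rightarrow> nat \<Rightarrow> nat" where
  "stirling_tail n d = (\<Sum>k | d + 2 \<le> k \<and> k \<le> n \<and> even (k - d). stirling n k)"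

text \<open>Weights and a common range, harmless because \<open>stirling n k\<close> vanishes for
  \<open>k > n\<close>, allow the index shift in the recurrence.\<close>

lemma stirling_tail_eq:
  assumes "n \<le> N"
  shows "stirling_tail n d = (\<Sum>k\<le>N. of_bool (d + 2 \<le> k \<and> even (k - d)) * stirling n k)"
proof -
  have "stirling_tail n d = (\<Sum>k | d + 2 \<le> k \<and> k \<le> n \<and> even (k - d). of_bool (d + 2 \<le> k \<and> even (k - d)) * stirling n k)"
    unfolding stirling_tail_def by (intro sum.cong) auto
  also have "\<dots> = (\<Sum>k\<le>N. of_bool (d + 2 \<le> k \<and> even (k - d)) * stirling n k)"
    using assms by (intro sum.mono_neutral_left) (auto simp: not_le)
  finally show ?thesis .
qed

text \<open>The recurrence of the Stirling numbers summed with weights; the weight is unchanged when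
  \<open>d\<close> and \<open>k\<close> both grow by one.\<close>

lemma stirling_tail_Suc:
  "stirling_tail (Suc n) (Suc d) = n * stirling_tail n (Suc d) + stirling_tail n d"
proof -
  define e :: "nat \<Rightarrow> nat \<Rightarrow> nat" where "e d k = of_bool (d + 2 \<le> k \<and> even (k - d))" for d k
  have eS: "e (Suc d) (Suc k) = e d k" "e (Suc d) 0 = 0" for k by (simp_all add: e_def)
  have tail: "stirling_tail m d = (\<Sum>k\<le>N. e d k * stirling m k)" if "m \<le> N" for m d N
    unfolding e_def by (rule stirling_tail_eq[OF that])
  have "stirling_tail (Suc n) (Suc d) = (\<Sum>k\<le>Suc n. e (Suc d) k * stirling (Suc n) k)"
    by (rule tail) simp
  also have "\<dots> = (\<Sum>k\<le>n. n * (e (Suc d) (Suc k) * stirling n (Suc k)) + e d k * stirling n k)"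
    unfolding sum.atMost_Suc_shift by (simp add: eS algebra_simps)
  also have "\<dots> = n * (\<Sum>k\<le>n. e (Suc d) (Suc k) * stirling n (Suc k)) + (\<Sum>k\<le>n. e d k * stirling n k)"
    by (simp only: sum.distrib sum_distrib_left)
  also have "(\<Sum>k\<le>n. e (Suc d) (Suc k) * stirling n (Suc k)) = (\<Sum>k\<le>Suc n. e (Suc d) k * stirling n k)"
    by (simp only: sum.atMost_Suc_shift eS)
  finally show ?thesis
    by (simp only: tail[of n "Suc n" "Suc d"] tail[of n n d] le_SucI order_refl)
qed

text \<open>The Stirling numbers sum to \<open>fact n\<close>, their alternating sum is a rising
  factorial at -1 and vanishes, so the even indices carry half of \<open>fact n\<close>.\<close>

lemma stirling_tail_0:
  assumes "n \<ge> 2"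
  shows "2 * stirling_tail n 0 = fact n"
proof -
  have z: "real (stirling n 0) = 0" using assms by simp
  \<comment> \<open>For \<open>n >= 2\<close> the product contains the factor
    \<open>-1 + 1\<close>.\<close>
  have "pochhammer (-1::real) n = 0"
    using assms by (auto simp: pochhammer_eq_0_iff intro!: exI[of _ 1])
  then have "(\<Sum>k\<le>n. real (stirling n k) * (-1) ^ k) = 0"
    using stirling_pochhammer[of n "-1::real"] by simp
  moreover have "(\<Sum>k\<le>n. real (stirling n k)) = fact n"
    using arg_cong[OF sum_stirling[of n], of real] by simp
  ultimately have "fact n = (\<Sum>k\<le>n. real (stirling n k) * (1 + (-1) ^ k))"
    by (simp add: distrib_left sum.distrib)
  also have "\<dots> = (\<Sum>k\<le>n. 2 * (of_bool (0 + 2 \<le> k \<and> even (k - 0)) * real (stirling n k)))"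
  proof (intro sum.cong refl)
    fix k :: nat
    consider "k = 0" | "k = 1" | "k \<ge> 2" by linarith
    then show "real (stirling n k) * (1 + (-1) ^ k) = 2 * (of_bool (0 + 2 \<le> k \<and> even (k - 0)) * real (stirling n k))"
      using z by cases auto
  qed
  also have "\<dots> = real (2 * stirling_tail n 0)"
    by (simp only: stirling_tail_eq[OF order_refl] of_nat_mult of_nat_sum of_nat_of_bool
        sum_distrib_left of_nat_numeral)
  finally show ?thesis by (metis of_nat_eq_iff of_nat_fact)
qed

lemma card_orderings:
  assumes "generic d I x" "card I \<ge> 2"
  shows "card (orderings I x) = 2 * stirling_tail (card I) d"
  using assms
proof (induction "card I" arbitrary: I x d rule: less_induct)
  case less
  have fin: "finite I" using less.prems by (simp add: generic_def)
  \<comment> \<open>Two boundary cases, with no chamber or every chamber met. In the third,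
    \<open>d >= 1\<close> leaves at least two indices after one is removed, so the induction
    hypothesis applies to both smaller families.\<close>
  consider "card I \<le> Suc d" | "d = 0" | e where "d = Suc e" "card I \<ge> d + 2"
    by (cases d) fastforce+
  then show ?case
  proof cases
    case 1
    then have "stirling_tail (card I) d = 0"
      unfolding stirling_tail_def by (intro sum.neutral) auto
    then show ?thesis using orderings_small less.prems 1 by fastforce
  next
    case 2
    then show ?thesis using card_orderings_0 stirling_tail_0 less.prems by metis
  next
    case 3
    obtain a where a: "a \<in> I" using less.prems(2) by fastforce
    define J where "J = I - {a}"
    have I: "I = insert a J" and aJ: "a \<notin> J" using a by (auto simp: J_def)
    have J: "card I = Suc (card J)" "card J \<ge> Suc d" using I aJ fin 3 by auto
    have g: "generic d (insert a J) x" using less.prems I by simp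
    have "card (orderings J (\<lambda>i. reject (x a) (x i))) = 2 * stirling_tail (card J) e"
      using less.hyps[of J e] generic_reject[of e a J x] g aJ J 3 by simp
    moreover have "card (orderings J (merge a x b)) = 2 * stirling_tail (card J) d" if "b \<in> J" for b
      using less.hyps[of J d] generic_merge[OF g aJ that] J 3 by simp
    ultimately show ?thesis
      using card_orderings_insert[OF g aJ J(2)] J(1) 3 unfolding I[symmetric]
      by (simp add: stirling_tail_Suc)
  qed
qed

section \<open>Convex hulls of partial sums\<close>

lemma span_image_sum:
  fixes S :: "'i \<Rightarrow> 'v::real_vector"
  assumes "finite I" "w \<in> span (S ` I)"
  shows "\<exists>c. w = (\<Sum>k\<in>I. c k *\<^sub>R S k)"
  using assms
proof (induction I arbitrary: w rule: finite_induct)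
  case (insert a I)
  from insert.prems obtain t where "w - t *\<^sub>R S a \<in> span (S ` I)"
    unfolding image_insert span_breakdown_eq by blast
  from insert.IH[OF this] obtain c where "w - t *\<^sub>R S a = (\<Sum>k\<in>I. c k *\<^sub>R S k)" by blast
  moreover have "(\<Sum>k\<in>I. (c(a := t)) k *\<^sub>R S k) = (\<Sum>k\<in>I. c k *\<^sub>R S k)"
    using insert.hyps by (intro sum.cong) auto
  ultimately have "w = (\<Sum>k\<in>insert a I. (c(a := t)) k *\<^sub>R S k)"
    using insert.hyps by (simp add: algebra_simps)
  then show ?case by blast
qed simp

lemma lin_indep_span:
  fixes S :: "'i \<Rightarrow> 'v::euclidean_space"
  assumes "finite I" "card I = DIM('v)" "lin_indep I S"
  shows "span (S ` I) = UNIV"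
proof -
  have "\<not> dim (S ` I) < card I"
    using linear_relation_exists[OF assms(1), of S] assms(3) unfolding lin_indep_def by metis
  moreover have "dim (S ` I) \<le> DIM('v)" by (rule dim_subset_UNIV)
  ultimately show ?thesis using assms(2) by (simp add: dim_eq_full[symmetric])
qed

text \<open>The support of such a relation fits into a \<open>d\<close>-element subset of
  \<open>K\<close>, whose vectors are independent.\<close>

lemma lin_indep_support:
  fixes S :: "'i \<Rightarrow> 'v::real_vector"
  assumes fin: "finite K" and "d \<le> card K"
    and indep: "\<And>I. I \<subseteq> K \<Longrightarrow> card I = d \<Longrightarrow> lin_indep I S"
    and rel: "(\<Sum>k\<in>K. c k *\<^sub>R S k) = 0" and supp: "card {k \<in> K. c k \<noteq> 0} \<le> d" and k: "k \<in> K"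
  shows "c k = 0"
proof -
  let ?T = "{k \<in> K. c k \<noteq> 0}"
  obtain I where I: "?T \<subseteq> I" "I \<subseteq> K" "card I = d"
    using exists_subset_between[of ?T d K] supp assms(2) fin by auto
  have "(\<Sum>k\<in>I. c k *\<^sub>R S k) = (\<Sum>k\<in>K. c k *\<^sub>R S k)"
    using I fin by (intro sum.mono_neutral_left) auto
  then have "\<forall>k\<in>I. c k = 0" using indep[OF I(2,3)] rel unfolding lin_indep_def by simp
  then show ?thesis using I(1) k by blast
qed

text \<open>General position upgrades nonnegative weights to positive ones: a nonzero relation has
  more than \<open>DIM('v)\<close> nonzero weights, so vectors of positive weight already span the
  space and can compensate a small increase of all the others.\<close>

lemma zero_in_hull_iff:
  fixes S :: "'i \<Rightarrow> 'v::euclidean_space"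
  assumes fin: "finite K" and d: "DIM('v) \<le> card K"
    and indep: "\<And>I. I \<subseteq> K \<Longrightarrow> card I = DIM('v) \<Longrightarrow> lin_indep I S"
  shows "0 \<in> convex hull (S ` K) \<longleftrightarrow> (\<exists>c. (\<forall>k\<in>K. 0 < c k) \<and> (\<Sum>k\<in>K. c k *\<^sub>R S k) = 0)"
proof
  assume "0 \<in> convex hull (S ` K)"
  then obtain u where u: "\<And>v. v \<in> S ` K \<Longrightarrow> 0 \<le> u v" "sum u (S ` K) = 1" "(\<Sum>v\<in>S ` K. u v *\<^sub>R v) = 0"
    unfolding convex_hull_finite[OF finite_imageI[OF fin]] mem_Collect_eq by blast
  \<comment> \<open>The hull gives weights on vectors, not indices; \<open>g\<close> picks one index
    per vector, and the other indices get weight 0.\<close>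
  define g where "g = inv_into K S"
  have g: "g v \<in> K" "S (g v) = v" if "v \<in> S ` K" for v
    using that by (auto simp: g_def f_inv_into_f inv_into_into)
  define l where "l k = (if k \<in> g ` S ` K then u (S k) else 0)" for k
  have l0: "0 \<le> l k" if "k \<in> K" for k using u(1) that by (auto simp: l_def)
  have lsum: "(\<Sum>k\<in>K. l k *\<^sub>R S k) = 0"
  proof -
    have "(\<Sum>k\<in>K. l k *\<^sub>R S k) = (\<Sum>k\<in>g ` S ` K. u (S k) *\<^sub>R S k)"
      using fin g by (intro sum.mono_neutral_cong_right) (auto simp: l_def)
    also have "\<dots> = (\<Sum>v\<in>S ` K. u v *\<^sub>R v)"
      by (subst sum.reindex) (auto simp: g_def inj_on_inv_into f_inv_into_f intro!: sum.cong)
    finally show ?thesis using u by simp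
  qed
  have "\<exists>v\<in>S ` K. u v \<noteq> 0"
  proof (rule ccontr)
    assume "\<not> (\<exists>v\<in>S ` K. u v \<noteq> 0)"
    then have "sum u (S ` K) = 0" by (intro sum.neutral) blast
    then show False using u(2) by simp
  qed
  then obtain v where v: "v \<in> S ` K" "u v \<noteq> 0" by blast
  then have lv: "l (g v) \<noteq> 0" "g v \<in> K" using g[OF v(1)] by (simp_all add: l_def)
  have "\<not> card {k \<in> K. l k \<noteq> 0} \<le> DIM('v)"
  proof
    assume "card {k \<in> K. l k \<noteq> 0} \<le> DIM('v)"
    from lin_indep_support[OF fin d indep lsum this lv(2)] lv(1) show False by contradiction
  qed
  then have "DIM('v) \<le> card {k \<in> K. l k \<noteq> 0}" by simp
  \<comment> \<open>On \<open>I\<close> the weights \<open>l\<close> are positive, so the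
    coefficients \<open>b\<close> below may have any sign.\<close>
  then obtain I where I: "I \<subseteq> {k \<in> K. l k \<noteq> 0}" "card I = DIM('v)"
    by (rule obtain_subset_with_card_n)
  have IK: "I \<subseteq> K" using I(1) by blast
  have finI: "finite I" using finite_subset[OF IK fin] .
  have "- (\<Sum>k\<in>K - I. S k) \<in> span (S ` I)"
    using lin_indep_span[OF finI I(2) indep[OF IK I(2)]] by simp
  then obtain b where b: "- (\<Sum>k\<in>K - I. S k) = (\<Sum>k\<in>I. b k *\<^sub>R S k)"
    using span_image_sum[OF finI] by metis
  \<comment> \<open>Adding a small multiple of the relation \<open>v\<close> makes all coefficients positive.\<close>
  define v where "v k = (if k \<in> I then b k else 1)" for k
  have "(\<Sum>k\<in>K. v k *\<^sub>R S k) = (\<Sum>k\<in>K - I. v k *\<^sub>R S k) + (\<Sum>k\<in>I. v k *\<^sub>R S k)"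
    by (rule sum.subset_diff[OF IK fin])
  also have "\<dots> = (\<Sum>k\<in>K - I. S k) + (\<Sum>k\<in>I. b k *\<^sub>R S k)"
    by (simp add: v_def)
  also have "\<dots> = 0" unfolding b[symmetric] by simp
  finally have vsum: "(\<Sum>k\<in>K. v k *\<^sub>R S k) = 0" .
  have "eventually (\<lambda>e. 0 < l k + e * v k) (at_right 0)" if "k \<in> K" for k
  proof (rule eventually_perturbed_pos)
    show "0 < l k \<or> l k = 0 \<and> 0 < v k"
      using l0[OF that] I(1) by (cases "k \<in> I") (auto simp: v_def)
  qed
  then have "eventually (\<lambda>e. \<forall>k\<in>K. 0 < l k + e * v k) (at_right 0)"
    using fin by (simp add: eventually_ball_finite)
  then obtain e where e: "\<forall>k\<in>K. 0 < l k + e * v k"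
    using eventually_happens' trivial_limit_at_right_real by blast
  have "(\<Sum>k\<in>K. (l k + e * v k) *\<^sub>R S k) = (\<Sum>k\<in>K. l k *\<^sub>R S k) + e *\<^sub>R (\<Sum>k\<in>K. v k *\<^sub>R S k)"
    by (simp only: scaleR_add_left sum.distrib scaleR_sum_right scaleR_scaleR)
  then have "(\<Sum>k\<in>K. (l k + e * v k) *\<^sub>R S k) = 0" using lsum vsum by simp
  with e show "\<exists>c. (\<forall>k\<in>K. 0 < c k) \<and> (\<Sum>k\<in>K. c k *\<^sub>R S k) = 0"
    by (intro exI[of _ "\<lambda>k. l k + e * v k"]) blast
next
  assume "\<exists>c. (\<forall>k\<in>K. 0 < c k) \<and> (\<Sum>k\<in>K. c k *\<^sub>R S k) = 0"
  then obtain c where c: "\<And>k. k \<in> K \<Longrightarrow> 0 < c k" "(\<Sum>k\<in>K. c k *\<^sub>R S k) = 0" by blast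
  have "K \<noteq> {}" using d by auto
  then have pos: "0 < sum c K" using c(1) fin by (simp add: sum_pos)
  have "(\<Sum>k\<in>K. (c k / sum c K) *\<^sub>R S k) \<in> convex hull (S ` K)"
  proof (rule convex_sum[OF fin convex_convex_hull])
    show "(\<Sum>k\<in>K. c k / sum c K) = 1" using pos by (simp add: sum_divide_distrib[symmetric])
    show "0 \<le> c k / sum c K" if "k \<in> K" for k using c(1)[OF that] pos by simp
    show "S k \<in> convex hull S ` K" if "k \<in> K" for k using that by (simp add: hull_inc)
  qed
  moreover have "(\<Sum>k\<in>K. (c k / sum c K) *\<^sub>R S k) = (1 / sum c K) *\<^sub>R (\<Sum>k\<in>K. c k *\<^sub>R S k)"
    by (simp add: scaleR_sum_right)
  ultimately show "0 \<in> convex hull (S ` K)" using c(2) by simp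
qed

section \<open>Partial sums along a permutation\<close>

lemma scaleR_summation_by_parts:
  fixes y :: "nat \<Rightarrow> 'v::real_vector"
  shows "(\<Sum>i\<in>{1..Suc m}. z i *\<^sub>R y i) =
    z (Suc m) *\<^sub>R (\<Sum>i\<in>{1..Suc m}. y i) - (\<Sum>k\<in>{1..m}. (z (Suc k) - z k) *\<^sub>R (\<Sum>i\<in>{1..k}. y i))"
  by (induction m) (simp_all add: algebra_simps)

lemma permutation_list_permutes:
  assumes "xs \<in> permutations_of_set {1..n}"
  obtains \<sigma> where "\<sigma> permutes {1..n}" "xs = map \<sigma> [1..<Suc n]"
proof -
  have xs: "distinct xs" "set xs = {1..n}" "length xs = n"
    using assms length_finite_permutations_of_set[OF assms] by (auto simp: permutations_of_setD)
  \<comment> \<open>List positions start at 0 and permuted indices at 1, hence the shift;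
    \<open>permutes\<close> requires the identity elsewhere.\<close>
  define \<sigma> where "\<sigma> i = (if i \<in> {1..n} then xs ! (i - 1) else i)" for i
  have "bij_betw (\<lambda>i. i - 1) {1..n} {..<n}"
    by (rule bij_betwI[where g = Suc]) auto
  moreover have "bij_betw ((!) xs) {..<n} {1..n}"
    by (rule bij_betw_nth) (simp_all add: xs)
  ultimately have "bij_betw ((!) xs \<circ> (\<lambda>i. i - 1)) {1..n} {1..n}" by (rule bij_betw_trans)
  then have "bij_betw \<sigma> {1..n} {1..n}"
    by (rule iffD1[OF bij_betw_cong, rotated]) (simp add: \<sigma>_def)
  then have "\<sigma> permutes {1..n}"
    by (rule bij_imp_permutes) (unfold \<sigma>_def, rule if_not_P)
  moreover have "xs = map \<sigma> [1..<Suc n]"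
    by (rule nth_equalityI) (simp_all add: xs \<sigma>_def del: upt_Suc)
  ultimately show thesis using that by blast
qed

text \<open>Substitute \<open>y i = z (\<sigma> i)\<close>; by transitivity, comparing neighbours is
  enough.\<close>

lemma orderings_map_iff:
  fixes x :: "nat \<Rightarrow> 'v::real_vector"
  assumes \<sigma>: "\<sigma> permutes {1..n}"
  shows "map \<sigma> [1..<Suc n] \<in> orderings {1..n} x \<longleftrightarrow>
    (\<exists>y. (\<Sum>i\<in>{1..n}. y i *\<^sub>R x (\<sigma> i)) = 0 \<and> (\<forall>k\<in>{1..<n}. y k < (y (Suc k) :: real)))"
proof -
  have perm: "map \<sigma> [1..<Suc n] \<in> permutations_of_set {1..n}"
    using permutes_image[OF \<sigma>] permutes_inj_on[OF \<sigma>]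
    by (intro permutations_of_setI)
      (simp_all only: distinct_map distinct_upt set_map set_upt atLeastLessThanSuc_atLeastAtMost simp_thms)
  have sorted: "sorted_wrt (\<lambda>a b. z a < z b) (map \<sigma> [1..<Suc n]) \<longleftrightarrow> (\<forall>k\<in>{1..<n}. z (\<sigma> k) < z (\<sigma> (Suc k)))"
    for z :: "nat \<Rightarrow> real"
  proof -
    have "sorted_wrt (\<lambda>a b. z a < z b) (map \<sigma> [1..<Suc n]) \<longleftrightarrow>
        (\<forall>i. Suc i < n \<longrightarrow> z (\<sigma> (Suc i)) < z (\<sigma> (Suc (Suc i))))"
      by (subst sorted_wrt_iff_nth_Suc_transp) (auto simp: transp_def simp del: upt_Suc)
    also have "\<dots> \<longleftrightarrow> (\<forall>k\<in>{1..<n}. z (\<sigma> k) < z (\<sigma> (Suc k)))"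
      by (metis One_nat_def Suc_le_D Suc_le_eq atLeastLessThan_iff le_add1 plus_1_eq_Suc)
    finally show ?thesis .
  qed
  have sum: "(\<Sum>i\<in>{1..n}. z i *\<^sub>R x i) = (\<Sum>i\<in>{1..n}. z (\<sigma> i) *\<^sub>R x (\<sigma> i))" for z
    by (rule sum.reindex_bij_betw[OF permutes_imp_bij[OF \<sigma>], symmetric])
  show ?thesis
  proof
    assume "map \<sigma> [1..<Suc n] \<in> orderings {1..n} x"
    then obtain z where "(\<Sum>i\<in>{1..n}. z i *\<^sub>R x i) = 0" "\<forall>k\<in>{1..<n}. z (\<sigma> k) < z (\<sigma> (Suc k))"
      unfolding orderings_def sorted mem_Collect_eq by blast
    then show "\<exists>y. (\<Sum>i\<in>{1..n}. y i *\<^sub>R x (\<sigma> i)) = 0 \<and> (\<forall>k\<in>{1..<n}. y k < (y (Suc k) :: real))"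
      unfolding sum by (intro exI[of _ "\<lambda>i. z (\<sigma> i)"]) blast
  next
    assume "\<exists>y. (\<Sum>i\<in>{1..n}. y i *\<^sub>R x (\<sigma> i)) = 0 \<and> (\<forall>k\<in>{1..<n}. y k < (y (Suc k) :: real))"
    then obtain y :: "nat \<Rightarrow> real"
      where y: "(\<Sum>i\<in>{1..n}. y i *\<^sub>R x (\<sigma> i)) = 0" "\<forall>k\<in>{1..<n}. y k < y (Suc k)" by blast
    define z where "z i = y (inv \<sigma> i)" for i
    have "z (\<sigma> i) = y i" for i using permutes_inverses(2)[OF \<sigma>] by (simp add: z_def)
    then show "map \<sigma> [1..<Suc n] \<in> orderings {1..n} x"
      unfolding orderings_def sorted mem_Collect_eq sum using perm y
      by (intro conjI exI[of _ z]) (simp_all only:)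
  qed
qed

text \<open>As the total sum vanishes, Abel summation leaves only the increments of \<open>y\<close>
  as coefficients of the partial sums; these are positive exactly when \<open>y\<close> is strictly
  increasing.\<close>

lemma zero_in_hull_iff_orderings:
  fixes x :: "nat \<Rightarrow> 'v::euclidean_space"
  assumes \<sigma>: "\<sigma> permutes {1..n}" and n: "DIM('v) + 1 \<le> n" and zero: "(\<Sum>i\<in>{1..n}. x i) = 0"
    and indep: "\<And>I. I \<subseteq> {1..n-1} \<Longrightarrow> card I = DIM('v) \<Longrightarrow> lin_indep I (\<lambda>k. \<Sum>i\<in>{1..k}. x (\<sigma> i))"
  shows "0 \<in> convex hull ((\<lambda>k. \<Sum>i\<in>{1..k}. x (\<sigma> i)) ` {1..n-1}) \<longleftrightarrow>
    map \<sigma> [1..<Suc n] \<in> orderings {1..n} x"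
proof -
  obtain m where m: "n = Suc m" using n by (cases n) auto
  have "(\<Sum>i\<in>{1..n}. x (\<sigma> i)) = 0"
    using sum.reindex_bij_betw[OF permutes_imp_bij[OF \<sigma>], of x] zero by simp
  then have parts: "(\<Sum>i\<in>{1..n}. y i *\<^sub>R x (\<sigma> i)) =
      - (\<Sum>k\<in>{1..m}. (y (Suc k) - y k) *\<^sub>R (\<Sum>i\<in>{1..k}. x (\<sigma> i)))" for y
    unfolding m scaleR_summation_by_parts by (simp only: m scaleR_zero_right diff_0)
  have K: "{1..<n} = {1..m}" "{1..n-1} = {1..m}" using m by auto
  have "0 \<in> convex hull ((\<lambda>k. \<Sum>i\<in>{1..k}. x (\<sigma> i)) ` {1..m}) \<longleftrightarrow>
     (\<exists>c. (\<forall>k\<in>{1..m}. 0 < c k) \<and> (\<Sum>k\<in>{1..m}. c k *\<^sub>R (\<Sum>i\<in>{1..k}. x (\<sigma> i))) = 0)"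
    by (rule zero_in_hull_iff) (use n m indep in auto)
  also have "\<dots> \<longleftrightarrow> (\<exists>y. (\<forall>k\<in>{1..m}. y k < (y (Suc k) :: real)) \<and>
      (\<Sum>k\<in>{1..m}. (y (Suc k) - y k) *\<^sub>R (\<Sum>i\<in>{1..k}. x (\<sigma> i))) = 0)"
  proof
    assume "\<exists>c. (\<forall>k\<in>{1..m}. 0 < c k) \<and> (\<Sum>k\<in>{1..m}. c k *\<^sub>R (\<Sum>i\<in>{1..k}. x (\<sigma> i))) = 0"
    then obtain c where c: "\<forall>k\<in>{1..m}. 0 < c k" "(\<Sum>k\<in>{1..m}. c k *\<^sub>R (\<Sum>i\<in>{1..k}. x (\<sigma> i))) = 0" by blast
    \<comment> \<open>The sums of \<open>c\<close> have the prescribed increments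
      \<open>c k\<close>; the term \<open>c 0\<close> only adds a constant on the indices
      used.\<close>
    have step: "sum c {..<Suc k} - sum c {..<k} = c k" for k by simp
    show "\<exists>y. (\<forall>k\<in>{1..m}. y k < (y (Suc k) :: real)) \<and>
        (\<Sum>k\<in>{1..m}. (y (Suc k) - y k) *\<^sub>R (\<Sum>i\<in>{1..k}. x (\<sigma> i))) = 0"
      using c by (intro exI[of _ "\<lambda>k. sum c {..<k}"]) (simp add: step)
  next
    assume "\<exists>y. (\<forall>k\<in>{1..m}. y k < (y (Suc k) :: real)) \<and>
        (\<Sum>k\<in>{1..m}. (y (Suc k) - y k) *\<^sub>R (\<Sum>i\<in>{1..k}. x (\<sigma> i))) = 0"
    then obtain y :: "nat \<Rightarrow> real" where "\<forall>k\<in>{1..m}. y k < y (Suc k)"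
        "(\<Sum>k\<in>{1..m}. (y (Suc k) - y k) *\<^sub>R (\<Sum>i\<in>{1..k}. x (\<sigma> i))) = 0" by blast
    then show "\<exists>c. (\<forall>k\<in>{1..m}. 0 < c k) \<and> (\<Sum>k\<in>{1..m}. c k *\<^sub>R (\<Sum>i\<in>{1..k}. x (\<sigma> i))) = 0"
      by (intro exI[of _ "\<lambda>k. y (Suc k) - y k"]) simp
  qed
  also have "\<dots> \<longleftrightarrow> map \<sigma> [1..<Suc n] \<in> orderings {1..n} x"
    unfolding orderings_map_iff[OF \<sigma>] parts K neg_equal_0_iff_equal by blast
  finally show ?thesis unfolding K .
qed

lemma sorting_permutation:
  fixes z :: "nat \<Rightarrow> 'b::linorder"
  obtains \<sigma> where "\<sigma> permutes {1..n}" "\<And>k. k \<in> {1..<n} \<Longrightarrow> z (\<sigma> k) \<le> z (\<sigma> (Suc k))"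
proof -
  let ?xs = "sort_key z [1..<Suc n]"
  have "?xs \<in> permutations_of_set {1..n}"
    by (intro permutations_of_setI) (auto simp del: upt_Suc)
  then obtain \<sigma> where \<sigma>: "\<sigma> permutes {1..n}" "?xs = map \<sigma> [1..<Suc n]"
    by (rule permutation_list_permutes)
  have "sorted (map z (map \<sigma> [1..<Suc n]))"
    unfolding \<sigma>(2)[symmetric] by simp
  then have sorted: "sorted (map (\<lambda>i. z (\<sigma> i)) [1..<Suc n])" by (simp add: comp_def del: upt_Suc)
  have nth: "map (\<lambda>i. z (\<sigma> i)) [1..<Suc n] ! i = z (\<sigma> (Suc i))" if "i < n" for i
    using that by (simp del: upt_Suc)
  have "z (\<sigma> k) \<le> z (\<sigma> (Suc k))" if k: "k \<in> {1..<n}" for k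
  proof -
    obtain j where j: "k = Suc j" "Suc j < n" using k by (cases k) auto
    then show ?thesis
      using sorted_nth_mono[OF sorted, of j "Suc j"] nth[of j] nth[of "Suc j"]
      by (simp only: length_map length_upt)
  qed
  then show thesis using that \<sigma>(1) by blast
qed

text \<open>Sort \<open>z\<close> by a permutation. At most \<open>d + 1\<close> values mean at most
  \<open>d\<close> jumps, and the jumps are the coefficients of a relation between the permuted
  partial sums; independence makes all of them zero.\<close>

lemma generic_of_partial_sums:
  fixes x :: "nat \<Rightarrow> 'v::euclidean_space"
  assumes n: "DIM('v) + 1 \<le> n" and zero: "(\<Sum>i\<in>{1..n}. x i) = 0"
    and indep: "\<And>\<sigma> I. \<sigma> permutes {1..n} \<Longrightarrow> I \<subseteq> {1..n-1} \<Longrightarrow> card I = DIM('v) \<Longrightarrow>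
      lin_indep I (\<lambda>k. \<Sum>i\<in>{1..k}. x (\<sigma> i))"
  shows "generic DIM('v) {1..n} x"
  unfolding generic_def
proof (intro conjI allI impI)
  show "dim (x ` {1..n}) \<le> DIM('v)" by (rule dim_subset_UNIV)
  fix z :: "nat \<Rightarrow> real"
  assume rel: "(\<Sum>i\<in>{1..n}. z i *\<^sub>R x i) = 0" and c: "card (z ` {1..n}) \<le> Suc DIM('v)"
  obtain m where m: "n = Suc m" using n by (cases n) auto
  obtain \<sigma> where \<sigma>: "\<sigma> permutes {1..n}" and le: "\<And>k. k \<in> {1..<n} \<Longrightarrow> z (\<sigma> k) \<le> z (\<sigma> (Suc k))"
    using sorting_permutation[of n z] by blast
  define y where "y k = z (\<sigma> k)" for k
  have yz: "y ` {1..n} = z ` {1..n}"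
    unfolding y_def image_image[of z \<sigma>, symmetric] permutes_image[OF \<sigma>] ..
  have mono: "y i \<le> y j" if "1 \<le> i" "i \<le> j" "j \<le> n" for i j
    using that(2,1,3)
  proof (induction j rule: dec_induct)
    case (step j)
    then show ?case using le[of j] by (simp add: y_def)
  qed simp
  have "(\<Sum>i\<in>{1..n}. y i *\<^sub>R x (\<sigma> i)) = 0"
    unfolding y_def using sum.reindex_bij_betw[OF permutes_imp_bij[OF \<sigma>], of "\<lambda>i. z i *\<^sub>R x i"] rel by simp
  moreover have "(\<Sum>i\<in>{1..n}. x (\<sigma> i)) = 0"
    using sum.reindex_bij_betw[OF permutes_imp_bij[OF \<sigma>], of x] zero by simp
  ultimately have s: "(\<Sum>k\<in>{1..m}. (y (Suc k) - y k) *\<^sub>R (\<Sum>i\<in>{1..k}. x (\<sigma> i))) = 0"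
    unfolding m scaleR_summation_by_parts by (simp only: scaleR_zero_right diff_0 neg_equal_0_iff_equal)
  let ?T = "{k \<in> {1..m}. y (Suc k) - y k \<noteq> 0}"
  have less: "y j < y (Suc k)" if "k \<in> ?T" "1 \<le> j" "j \<le> k" for j k
  proof -
    have "y j \<le> y k" using that m by (intro mono) simp_all
    moreover have "y k \<le> y (Suc k)" using that m by (intro mono) simp_all
    ultimately show ?thesis using that(1) by simp
  qed
  \<comment> \<open>Each jump reaches a new value, different also from the initial
    \<open>y 1\<close>, so there are fewer jumps than values.\<close>
  have "inj_on (\<lambda>k. y (Suc k)) ?T"
  proof (rule linorder_inj_onI')
    fix i j assume "i \<in> ?T" "j \<in> ?T" "i < j"
    then show "y (Suc i) \<noteq> y (Suc j)" using less[of j "Suc i"] by simp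
  qed
  then have "card ?T = card ((\<lambda>k. y (Suc k)) ` ?T)" by (simp add: card_image)
  also have "\<dots> < card (z ` {1..n})"
  proof (rule psubset_card_mono)
    have "y 1 \<noteq> y (Suc k)" if "k \<in> ?T" for k using less[OF that, of 1] that by simp
    then have "y 1 \<notin> (\<lambda>k. y (Suc k)) ` ?T" by blast
    moreover have "y 1 \<in> y ` {1..n}" using m by simp
    moreover have "(\<lambda>k. y (Suc k)) ` ?T \<subseteq> y ` {1..n}" using m by auto
    ultimately show "(\<lambda>k. y (Suc k)) ` ?T \<subset> z ` {1..n}" unfolding yz by blast
  qed simp
  finally have T: "card ?T \<le> DIM('v)" using c by simp
  have const_step: "y (Suc k) - y k = 0" if "k \<in> {1..m}" for k
    by (rule lin_indep_support[OF _ _ indep[OF \<sigma>] s T that]) (use n m in simp_all)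
  have const: "y k = y 1" if "1 \<le> k" "k \<le> n" for k
    using that
  proof (induction k rule: dec_induct)
    case (step k)
    then have "y (Suc k) - y k = 0" using const_step[of k] m by simp
    then show ?case using step by simp
  qed simp
  have "\<forall>v\<in>y ` {1..n}. v = y 1"
  proof (intro ballI)
    fix v assume "v \<in> y ` {1..n}"
    then obtain k where "v = y k" "1 \<le> k" "k \<le> n" by auto
    then show "v = y 1" using const[of k] by simp
  qed
  then have "\<forall>v\<in>z ` {1..n}. v = y 1" unfolding yz .
  then show "\<exists>c. \<forall>i\<in>{1..n}. z i = c" by blast
qed simp

section \<open>Exchangeable sums\<close>

theorem theorem2p1:
  fixes M :: "'a measure" and \<xi> :: "nat \<Rightarrow> 'a \<Rightarrow> real ^ 'd" and n :: nat
  assumes "prob_space M"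
    and "n \<ge> CARD('d) + 1"
    and "\<And>i. i \<in> {1..n} \<Longrightarrow> \<xi> i \<in> borel_measurable M"
    and "\<And>\<sigma>. \<sigma> permutes {1..n} \<Longrightarrow>
           distr M (PiM {1..n} (\<lambda>_. borel)) (\<lambda>\<omega>. \<lambda>i\<in>{1..n}. \<xi> i \<omega>) =
           distr M (PiM {1..n} (\<lambda>_. borel)) (\<lambda>\<omega>. \<lambda>i\<in>{1..n}. \<xi> (\<sigma> i) \<omega>)"
    and "AE \<omega> in M. psum \<xi> n \<omega> = 0"
    and "\<And>I. I \<subseteq> {1..n-1} \<Longrightarrow> card I = CARD('d) \<Longrightarrow>
           AE \<omega> in M. inj_on (\<lambda>k. psum \<xi> k \<omega>) I \<and>
                       independent ((\<lambda>k. psum \<xi> k \<omega>) ` I)"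
  shows "measure M {\<omega> \<in> space M. 0 \<in> convex hull ((\<lambda>k. psum \<xi> k \<omega>) ` {1..n-1})} =
         2 / fact n * real (\<Sum>k | CARD('d) + 2 \<le> k \<and> k \<le> n \<and> even (k - CARD('d)). stirling n k)"
proof -
  interpret prob_space M by fact
  have n: "DIM(real ^ 'd) + 1 \<le> n" using assms(2) by simp
  \<comment> \<open>The deterministic core: for fixed vectors in general position with zero sum, the
    number of favourable permutations does not depend on the vectors.\<close>
  have card_hull: "card {\<sigma>. \<sigma> permutes {1..n} \<and>
        0 \<in> convex hull ((\<lambda>k. \<Sum>i\<in>{1..k}. x (\<sigma> i)) ` {1..n-1})} = 2 * stirling_tail n DIM(real ^ 'd)"
    if zero: "(\<Sum>i\<in>{1..n}. x i) = 0"
      and indep: "\<And>\<sigma> I. \<sigma> permutes {1..n} \<Longrightarrow> I \<subseteq> {1..n-1} \<Longrightarrow> card I = DIM(real ^ 'd) \<Longrightarrow>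
        lin_indep I (\<lambda>k. \<Sum>i\<in>{1..k}. x (\<sigma> i))"
    for x :: "nat \<Rightarrow> real ^ 'd"
  proof -
    have gen: "generic DIM(real ^ 'd) {1..n} x" by (rule generic_of_partial_sums[OF n zero indep])
    let ?f = "\<lambda>\<sigma>. map \<sigma> [1..<Suc n]"
    let ?P = "{\<sigma>. \<sigma> permutes {1..n} \<and> 0 \<in> convex hull ((\<lambda>k. \<Sum>i\<in>{1..k}. x (\<sigma> i)) ` {1..n-1})}"
    have P: "\<sigma> \<in> ?P \<longleftrightarrow> \<sigma> permutes {1..n} \<and> ?f \<sigma> \<in> orderings {1..n} x" for \<sigma>
    proof (cases "\<sigma> permutes {1..n}")
      case True
      show ?thesis
        using zero_in_hull_iff_orderings[OF True n zero indep[OF True]] True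
        by (simp only: mem_Collect_eq simp_thms)
    qed (simp only: mem_Collect_eq simp_thms)
    have "inj_on ?f ?P"
    proof (rule inj_onI)
      fix \<sigma> \<tau> assume *: "\<sigma> \<in> ?P" "\<tau> \<in> ?P" and eq: "?f \<sigma> = ?f \<tau>"
      have perm: "\<sigma> permutes {1..n}" "\<tau> permutes {1..n}"
        using * unfolding P by (simp_all only: simp_thms)
      show "\<sigma> = \<tau>"
      proof
        fix i show "\<sigma> i = \<tau> i"
        proof (cases "i \<in> {1..n}")
          case True
          moreover have "\<forall>i\<in>set [1..<Suc n]. \<sigma> i = \<tau> i" using eq by (simp only: map_eq_conv)
          ultimately show ?thesis by (simp only: set_upt atLeastLessThanSuc_atLeastAtMost)
        next
          case False
          then show ?thesis using permutes_not_in[OF perm(1)] permutes_not_in[OF perm(2)] by simp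
        qed
      qed
    qed
    moreover have "?f ` ?P = orderings {1..n} x"
    proof (intro equalityI subsetI)
      fix xs assume xs: "xs \<in> orderings {1..n} x"
      then have "xs \<in> permutations_of_set {1..n}" by (simp add: orderings_def)
      then obtain \<sigma> where "\<sigma> permutes {1..n}" "xs = ?f \<sigma>" by (rule permutation_list_permutes)
      moreover from this have "\<sigma> \<in> ?P" unfolding P using xs by (simp only: simp_thms)
      ultimately show "xs \<in> ?f ` ?P" by (intro image_eqI)
    next
      fix xs assume "xs \<in> ?f ` ?P"
      then obtain \<sigma> where "\<sigma> \<in> ?P" "xs = ?f \<sigma>" by (rule imageE)
      then show "xs \<in> orderings {1..n} x" unfolding P by (simp only:)
    qed
    ultimately have "card ?P = card (orderings {1..n} x)"
      using card_image[of ?f ?P] by (simp only:)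
    also have "\<dots> = 2 * stirling_tail n DIM(real ^ 'd)"
      using card_orderings[OF gen] n DIM_positive[where 'a = "real ^ 'd"] by simp
    finally show ?thesis .
  qed
  let ?P = "PiM {1..n} (\<lambda>_. borel :: (real ^ 'd) measure)"
  let ?\<Pi> = "{\<sigma>. \<sigma> permutes {1..n}}"
  \<comment> \<open>The permuted tuples as random elements of the product space; exchangeability
    gives them one common law, and \<open>S\<close> reads partial sums off a tuple.\<close>
  define X where "X \<sigma> \<omega> = (\<lambda>i\<in>{1..n}. \<xi> (\<sigma> i) \<omega>)" for \<sigma> \<omega>
  define S where "S f k = (\<Sum>i\<in>{1..k}. f i)" for f :: "nat \<Rightarrow> real ^ 'd" and k
  have X[measurable]: "X \<sigma> \<in> measurable M ?P" if "\<sigma> permutes {1..n}" for \<sigma>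
    unfolding X_def using assms(3) permutes_in_image[OF that] by (intro measurable_restrict) simp
  have distr: "distr M ?P (X \<sigma>) = distr M ?P (X id)" if "\<sigma> permutes {1..n}" for \<sigma>
    using assms(4)[OF that] unfolding X_def[abs_def] by simp
  have SX: "S (X \<sigma> \<omega>) k = (\<Sum>i\<in>{1..k}. \<xi> (\<sigma> i) \<omega>)" if "k \<le> n" for \<sigma> \<omega> k
    unfolding S_def X_def using that by (intro sum.cong) auto
  have psum: "S (X id \<omega>) k = psum \<xi> k \<omega>" if "k \<le> n" for \<omega> k
    unfolding SX[OF that] psum_def by simp
  have S: "(\<lambda>f. S f k) \<in> borel_measurable ?P" if "k \<le> n" for k
    unfolding S_def using that by (intro borel_measurable_sum measurable_component_singleton) auto
  have indep_id: "AE \<omega> in M. lin_indep I (S (X id \<omega>))" if I: "I \<subseteq> {1..n-1}" "card I = CARD('d)" for I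
  proof (rule AE_mp[OF assms(6)[OF I]], intro AE_I2 impI)
    fix \<omega> assume *: "inj_on (\<lambda>k. psum \<xi> k \<omega>) I \<and> independent ((\<lambda>k. psum \<xi> k \<omega>) ` I)"
    have eq: "S (X id \<omega>) k = psum \<xi> k \<omega>" if "k \<in> I" for k using subsetD[OF I(1) that] by (intro psum) auto
    show "lin_indep I (S (X id \<omega>))"
      using * finite_subset[OF I(1)] by (intro lin_indepI_independent) (simp_all add: eq cong: inj_on_cong image_cong)
  qed
  \<comment> \<open>Independence is assumed for the original order only; the common law carries it
    to every permutation.\<close>
  have indep: "AE \<omega> in M. lin_indep I (S (X \<sigma> \<omega>))"
    if \<sigma>: "\<sigma> permutes {1..n}" and I: "I \<subseteq> {1..n-1}" "card I = CARD('d)" for \<sigma> I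
  proof -
    have sets: "{f \<in> space ?P. lin_indep I (S f)} \<in> sets ?P"
    proof (rule sets_lin_indep[OF finite_subset[OF I(1)] I(2)])
      fix k assume "k \<in> I"
      then show "(\<lambda>f. S f k) \<in> borel_measurable ?P" using subsetD[OF I(1)] by (intro S) fastforce
    qed simp
    have "AE f in distr M ?P (X id). lin_indep I (S f)"
      using indep_id[OF I] by (subst AE_distr_iff[OF X sets]) (simp_all add: permutes_id)
    then have "AE f in distr M ?P (X \<sigma>). lin_indep I (S f)" by (simp only: distr[OF \<sigma>])
    then show ?thesis by (subst (asm) AE_distr_iff[OF X[OF \<sigma>] sets])
  qed
  \<comment> \<open>There are finitely many pairs of \<sigma> and \<open>I\<close>, so one null set
    serves all.\<close>
  have AE_indep: "AE \<omega> in M. \<forall>\<sigma>\<in>?\<Pi>. \<forall>I\<in>{I. I \<subseteq> {1..n-1} \<and> card I = CARD('d)}. lin_indep I (S (X \<sigma> \<omega>))"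
    by (intro AE_finite_allI finite_permutations) (use indep in auto)
  define E where "E \<sigma> = {\<omega> \<in> space M. 0 \<in> convex hull (S (X \<sigma> \<omega>) ` {1..n-1})}" for \<sigma>
  let ?H = "{f \<in> space ?P. 0 \<in> convex hull (S f ` {1..n-1})}"
  have H: "?H \<in> sets ?P"
    by (rule sets_zero_in_hull) (use S in auto)
  have E_vimage: "E \<sigma> = X \<sigma> -` ?H \<inter> space M" if "\<sigma> permutes {1..n}" for \<sigma>
    unfolding E_def using measurable_space[OF X[OF that]] by auto
  have E_sets[measurable]: "E \<sigma> \<in> sets M" if "\<sigma> permutes {1..n}" for \<sigma>
    unfolding E_vimage[OF that] by (rule measurable_sets[OF X[OF that] H])
  have prob_E: "prob (E \<sigma>) = prob (E id)" if \<sigma>: "\<sigma> permutes {1..n}" for \<sigma>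
  proof -
    have "prob (E \<tau>) = measure (distr M ?P (X \<tau>)) ?H" if "\<tau> permutes {1..n}" for \<tau>
      unfolding E_vimage[OF that] by (rule measure_distr[OF X[OF that] H, symmetric])
    from this[OF \<sigma>] this[OF permutes_id] show ?thesis unfolding distr[OF \<sigma>] by (rule trans[OF _ sym])
  qed
  have count: "AE \<omega> in M. (\<Sum>\<sigma>\<in>?\<Pi>. indicator (E \<sigma>) \<omega>) = real (2 * stirling_tail n CARD('d))"
    using AE_indep assms(5) AE_space
  proof eventually_elim
    case (elim \<omega>)
    have "(\<Sum>i\<in>{1..n}. \<xi> i \<omega>) = 0" using elim(2) by (simp add: psum_def)
    moreover have "lin_indep I (\<lambda>k. \<Sum>i\<in>{1..k}. \<xi> (\<sigma> i) \<omega>)"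
      if "\<sigma> permutes {1..n}" "I \<subseteq> {1..n-1}" "card I = DIM(real ^ 'd)" for \<sigma> I
    proof -
      have "lin_indep I (S (X \<sigma> \<omega>))" using elim(1) that by simp
      moreover have "S (X \<sigma> \<omega>) k = (\<Sum>i\<in>{1..k}. \<xi> (\<sigma> i) \<omega>)" if "k \<in> I" for k
        using subsetD[OF \<open>I \<subseteq> {1..n-1}\<close> that] by (intro SX) auto
      ultimately show ?thesis by (simp add: lin_indep_def cong: sum.cong)
    qed
    ultimately have "card {\<sigma>. \<sigma> permutes {1..n} \<and>
        0 \<in> convex hull ((\<lambda>k. \<Sum>i\<in>{1..k}. \<xi> (\<sigma> i) \<omega>) ` {1..n-1})} = 2 * stirling_tail n CARD('d)"
      using card_hull[of "\<lambda>i. \<xi> i \<omega>"] by auto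
    moreover have "(\<lambda>k. \<Sum>i\<in>{1..k}. \<xi> (\<sigma> i) \<omega>) ` {1..n-1} = S (X \<sigma> \<omega>) ` {1..n-1}" for \<sigma>
      by (intro image_cong refl SX[symmetric]) auto
    ultimately have "card (?\<Pi> \<inter> {\<sigma>. \<omega> \<in> E \<sigma>}) = 2 * stirling_tail n CARD('d)"
      unfolding E_def using elim(3) by (auto simp: Int_def)
    moreover have "(\<Sum>\<sigma>\<in>?\<Pi>. indicator (E \<sigma>) \<omega>) = real (card (?\<Pi> \<inter> {\<sigma>. \<omega> \<in> E \<sigma>}))"
      by (simp add: indicator_def finite_permutations)
    ultimately show ?case by simp
  qed
  \<comment> \<open>The events \<open>E \<sigma>\<close> are equally likely, so their probabilities
    add up to \<open>fact n * prob (E id)\<close>; this is also the expectation of the almost surely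
    constant count.\<close>
  have "fact n * prob (E id) = (\<Sum>\<sigma>\<in>?\<Pi>. prob (E id))"
    by (simp add: card_permutations)
  also have "\<dots> = (\<Sum>\<sigma>\<in>?\<Pi>. prob (E \<sigma>))"
    by (intro sum.cong refl prob_E[symmetric]) simp
  also have "\<dots> = expectation (\<lambda>\<omega>. \<Sum>\<sigma>\<in>?\<Pi>. indicator (E \<sigma>) \<omega>)"
    using E_sets by (subst Bochner_Integration.integral_sum) (auto simp: emeasure_eq_measure)
  also have "\<dots> = expectation (\<lambda>\<omega>. real (2 * stirling_tail n CARD('d)))"
    using E_sets by (intro integral_cong_AE count borel_measurable_sum borel_measurable_indicator) auto
  also have "\<dots> = real (2 * stirling_tail n CARD('d))" by (simp add: prob_space)
  finally have "prob (E id) = 2 / fact n * real (stirling_tail n CARD('d))"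
    by (simp add: field_simps)
  moreover have "S (X id \<omega>) ` {1..n-1} = (\<lambda>k. psum \<xi> k \<omega>) ` {1..n-1}" for \<omega>
    by (intro image_cong refl psum) auto
  then have "E id = {\<omega> \<in> space M. 0 \<in> convex hull ((\<lambda>k. psum \<xi> k \<omega>) ` {1..n-1})}"
    unfolding E_def by (simp only:)
  ultimately show ?thesis unfolding stirling_tail_def by simp
qed

end
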